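(* Let $d\geqslant 3$, let $\ell$ be a prime power, and let $U(2d,\ell)$ be the dual polar graph on $[{}^2\!A_{2d-1}(\ell)]$, equipped with its second $Q$-polynomial ordering, i.e. the standard $Q$-polynomial ordering with respect to the classical parameters $(d,-\ell,\alpha,\beta)$ where $\alpha+1=\frac{1+\ell^2}{1-\ell}$... $U(2d,\ell)$ being read with $\alpha+1=\frac{1+\ell^2}{1-\ell}$ and $\beta+1=\frac{1-(-\ell)^{d+1}}{1-\ell}$. Then $U(2d,\ell)$ has no nontrivial descendent.
   Context: All graphs are finite, simple and undirected. Let $\Gamma$ be a connected graph with vertex set $X$, path-length distance $\partial$ and diameter $d$; let $A_i\in\mathbb{C}^{X\times X}$ be the adjacency matrix of the distance-$i$ graph ($A_0=I$). $\Gamma$ is distance-regular if there are integers $b_i,c_i$ such that whenever $\partial(x,y)=i$, $y$ has exactly $b_i$ (resp. $c_i$) neighbours at distance $i+1$ (resp. $i-1$) from $x$. Then the Bose--Mesner algebra $\langle A_0,\dots,A_d\rangle$ (complex span) is a commutative semisimple algebra with a basis of primitive idempotents $E_0=|X|^{-1}J,E_1,\dots,E_d$. $\Gamma$ is $Q$-polynomial with respect to the ordering $\{E_i\}_{i=0}^d$ if there are scalars $a_i^*,b_i^*,c_i^*$ with $b_d^*=c_0^*=0$, $b_{i-1}^*c_i^*\neq 0$ $(1\leqslant i\leqslant d)$ and $E_1\circ E_i=|X|^{-1}(b_{i-1}^*E_{i-1}+a_i^*E_i+c_{i+1}^*E_{i+1})$ $(0\leqslant i\leqslant d)$, where $\circ$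 is the entrywise product, $E_{-1}=E_{d+1}=0$, $b_{-1}^*=c_{d+1}^*=0$. Write $|X|E_1=\sum_{i=0}^d\theta_i^*A_i$. For a nonempty $Y\subseteq X$ with characteristic vector $\hat Y$, the width is $w=\max\{i:\hat Y^{\mathsf T}A_i\hat Y\neq 0\}$ and the dual width is $w^*=\max\{i:\hat Y^{\mathsf T}E_i\hat Y\neq 0\}$. One always has $w+w^*\geqslant d$; $Y$ is a descendent of $\Gamma$ if $w+w^*=d$; it is trivial if moreover $w=0$ or $w=d$ (a singleton or $X$), nontrivial otherwise. Put $[i]_q=1+q+\dots+q^{i-1}$. $\Gamma$ has classical parameters $(d,q,\alpha,\beta)$ if $b_i=([d]_q-[i]_q)(\beta-\alpha[i]_q)$ and $c_i=[i]_q(1+\alpha[i-1]_q)$ for $0\leqslant i\leqslant d$. Then $\Gamma$ has a $Q$-polynomial ordering, called standard (with respect to these classical parameters), for which $\theta_i^*=\xi^*[d-i]_q+\zeta^*$ for some scalars $\xi^*\neq 0$, $\zeta^*$. $U(2d,\ell)$ has as vertices the maximal isotropic subspaces (dimension $d$) of $\mathbb{F}_{\ell^2}^{2d}$ with a nondegenerate Hermitean form, adjacent when their intersection has dimension $d-1$. It is distance-regular with diameter $d$ and has two sets of classical parameters: the ordinary ones $(d,\ell^2,0,\ell)$, and $(d,-\ell,\alpha,\beta)$ with $\alpha+1=\frac{1+\ell^2}{1-\ell}$, $\beta+1=\frac{1-(-\ell)^{d+1}}{1-\ell}$. If $\{E_i\}_{i=0}^d$ is the standard ordering for the ordinary parameters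 $(d,\ell^2,0,\ell)$, then the second ordering (standard for $(d,-\ell,\alpha,\beta)$) is $E_0,E_d,E_1,E_{d-1},\dots$. *)

theory Defs
  imports
    "HOL-Analysis.Analysis"
    "HOL-Number_Theory.Prime_Powers"
    "Graph_Theory.Pair_Digraph"
    "Graph_Theory.Digraph_Component"
begin

section \<open>Distance-regular graphs\<close>

text \<open>
  Graphs are the finite, loopless, symmetric digraphs without parallel arcs (\<^locale>\<open>pair_graph\<close>).
  The name \<open>connected\<close> is qualified because it is also a topological notion.
\<close>

definition graph_dist :: "'a pair_pre_digraph \<Rightarrow> 'a \<Rightarrow> 'a \<Rightarrow> nat" where
  "graph_dist G x y = (LEAST n. \<exists>p. pre_digraph.awalk (with_proj G) x p y \<and> length p = n)"

definition diam :: "'a pair_pre_digraph \<Rightarrow> nat" where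
  "diam G = Max {graph_dist G x y | x y. x \<in> pverts G \<and> y \<in> pverts G}"

definition intersection_numbers ::
  "'a pair_pre_digraph \<Rightarrow> (nat \<Rightarrow> int) \<Rightarrow> (nat \<Rightarrow> int) \<Rightarrow> bool" where
  "intersection_numbers G b c \<longleftrightarrow>
    (\<forall>x\<in>pverts G. \<forall>y\<in>pverts G. \<forall>i. graph_dist G x y = i \<longrightarrow>
       int (card {z. (y, z) \<in> parcs G \<and> graph_dist G x z = i + 1}) = b i \<and>
       int (card {z. (y, z) \<in> parcs G \<and> graph_dist G x z + 1 = i}) = c i)"

definition distance_regular :: "'a pair_pre_digraph \<Rightarrow> bool" where
  "distance_regular G \<longleftrightarrow>
    pair_graph G \<and> Digraph_Component.connected (with_proj G) \<and> (\<exists>b c. intersection_numbers G b c)"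

text \<open>The expression \<open>qnum q i\<close> is \<open>1 + q + \<dots> + q ^ (i - 1)\<close>.\<close>

definition qnum :: "real \<Rightarrow> nat \<Rightarrow> real" where
  "qnum q i = (\<Sum>j<i. q ^ j)"

text \<open>
  In the formula for \<open>c i\<close> the truncated subtraction at \<open>i = 0\<close> is harmless,
  since \<open>qnum q 0 = 0\<close>.
\<close>

definition classical_parameters ::
  "'a pair_pre_digraph \<Rightarrow> nat \<Rightarrow> real \<Rightarrow> real \<Rightarrow> real \<Rightarrow> bool" where
  "classical_parameters G d q \<alpha> \<beta> \<longleftrightarrow>
    distance_regular G \<and> diam G = d \<and>
    (\<exists>b c. intersection_numbers G b c \<and>
      (\<forall>i\<le>d. real_of_int (b i) = (qnum q d - qnum q i) * (\<beta> - \<alpha> * qnum q i) \<and>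
              real_of_int (c i) = qnum q i * (1 + \<alpha> * qnum q (i - 1))))"


section \<open>The Bose--Mesner algebra and Q-polynomial orderings\<close>

text \<open>
  A complex matrix with rows and columns indexed by \<open>pverts G\<close> is represented by a function
  that vanishes unless both arguments are vertices, so that equality of matrices is
  equality of functions.
\<close>

type_synonym 'a cmat = "'a \<Rightarrow> 'a \<Rightarrow> complex"

definition dist_mat :: "'a pair_pre_digraph \<Rightarrow> nat \<Rightarrow> 'a cmat" where
  "dist_mat G i = (\<lambda>x y. if x \<in> pverts G \<and> y \<in> pverts G \<and> graph_dist G x y = i then 1 else 0)"

definition all_ones :: "'a pair_pre_digraph \<Rightarrow> 'a cmat" where
  "all_ones G = (\<lambda>x y. if x \<in> pverts G \<and> y \<in> pverts G then 1 else 0)"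

definition mat_prod :: "'a pair_pre_digraph \<Rightarrow> 'a cmat \<Rightarrow> 'a cmat \<Rightarrow> 'a cmat" where
  "mat_prod G M N = (\<lambda>x y. \<Sum>z\<in>pverts G. M x z * N z y)"

definition bose_mesner :: "'a pair_pre_digraph \<Rightarrow> 'a cmat set" where
  "bose_mesner G = {M. \<exists>c. M = (\<lambda>x y. \<Sum>i\<le>diam G. c i * dist_mat G i x y)}"

definition bm_idempotent :: "'a pair_pre_digraph \<Rightarrow> 'a cmat \<Rightarrow> bool" where
  "bm_idempotent G M \<longleftrightarrow> M \<in> bose_mesner G \<and> mat_prod G M M = M"

text \<open>
  Primitive: nonzero, and not the sum of two nonzero orthogonal idempotents of the algebra.
\<close>

definition primitive_idempotent :: "'a pair_pre_digraph \<Rightarrow> 'a cmat \<Rightarrow> bool" where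
  "primitive_idempotent G M \<longleftrightarrow>
    bm_idempotent G M \<and> M \<noteq> (\<lambda>x y. 0) \<and>
    \<not> (\<exists>F F'. bm_idempotent G F \<and> bm_idempotent G F' \<and>
          F \<noteq> (\<lambda>x y. 0) \<and> F' \<noteq> (\<lambda>x y. 0) \<and>
          mat_prod G F F' = (\<lambda>x y. 0) \<and> mat_prod G F' F = (\<lambda>x y. 0) \<and>
          M = (\<lambda>x y. F x y + F' x y))"

text \<open>
  The conditionals implement \<open>E\<^sub>-\<^sub>1 = E\<^sub>d\<^sub>+\<^sub>1 = 0\<close>. Only the values \<open>E i\<close> with
  \<open>i \<le> diam G\<close> are relevant.
\<close>

definition Q_polynomial :: "'a pair_pre_digraph \<Rightarrow> (nat \<Rightarrow> 'a cmat) \<Rightarrow> bool" where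
  "Q_polynomial G E \<longleftrightarrow>
    distance_regular G \<and>
    bij_betw E {..diam G} {M. primitive_idempotent G M} \<and>
    E 0 = (\<lambda>x y. all_ones G x y / of_nat (card (pverts G))) \<and>
    (\<exists>a b c :: nat \<Rightarrow> complex.
       b (diam G) = 0 \<and> c 0 = 0 \<and>
       (\<forall>i\<in>{1..diam G}. b (i - 1) * c i \<noteq> 0) \<and>
       (\<forall>i\<le>diam G. \<forall>x y.
          E 1 x y * E i x y =
            ((if i = 0 then 0 else b (i - 1) * E (i - 1) x y)
             + a i * E i x y
             + (if i = diam G then 0 else c (i + 1) * E (i + 1) x y))
            / of_nat (card (pverts G))))"

definition dual_eigenvalues ::
  "'a pair_pre_digraph \<Rightarrow> (nat \<Rightarrow> 'a cmat) \<Rightarrow> (nat \<Rightarrow> complex) \<Rightarrow> bool" where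
  "dual_eigenvalues G E \<theta> \<longleftrightarrow>
    (\<forall>x y. of_nat (card (pverts G)) * E 1 x y = (\<Sum>i\<le>diam G. \<theta> i * dist_mat G i x y))"

definition standard_ordering ::
  "'a pair_pre_digraph \<Rightarrow> nat \<Rightarrow> real \<Rightarrow> real \<Rightarrow> real \<Rightarrow> (nat \<Rightarrow> 'a cmat) \<Rightarrow> bool" where
  "standard_ordering G d q \<alpha> \<beta> E \<longleftrightarrow>
    classical_parameters G d q \<alpha> \<beta> \<and> Q_polynomial G E \<and>
    (\<exists>\<theta> \<xi> \<zeta>. dual_eigenvalues G E \<theta> \<and> \<xi> \<noteq> 0 \<and>
       (\<forall>i\<le>d. \<theta> i = \<xi> * of_real (qnum q (d - i)) + \<zeta>))"


section \<open>Width, dual width and descendents\<close>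

text \<open>The value of \<open>quad_at G Y M\<close> is the quadratic form of \<open>M\<close> at the characteristic vector of \<open>Y\<close>.\<close>

definition quad_at :: "'a pair_pre_digraph \<Rightarrow> 'a set \<Rightarrow> 'a cmat \<Rightarrow> complex" where
  "quad_at G Y M = (\<Sum>x\<in>pverts G. \<Sum>y\<in>pverts G. indicator Y x * M x y * indicator Y y)"

definition width :: "'a pair_pre_digraph \<Rightarrow> 'a set \<Rightarrow> nat" where
  "width G Y = Max {i. i \<le> diam G \<and> quad_at G Y (dist_mat G i) \<noteq> 0}"

definition dual_width :: "'a pair_pre_digraph \<Rightarrow> (nat \<Rightarrow> 'a cmat) \<Rightarrow> 'a set \<Rightarrow> nat" where
  "dual_width G E Y = Max {i. i \<le> diam G \<and> quad_at G Y (E i) \<noteq> 0}"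

definition descendent :: "'a pair_pre_digraph \<Rightarrow> (nat \<Rightarrow> 'a cmat) \<Rightarrow> 'a set \<Rightarrow> bool" where
  "descendent G E Y \<longleftrightarrow>
    Y \<noteq> {} \<and> Y \<subseteq> pverts G \<and> width G Y + dual_width G E Y = diam G"

definition trivial_descendent :: "'a pair_pre_digraph \<Rightarrow> (nat \<Rightarrow> 'a cmat) \<Rightarrow> 'a set \<Rightarrow> bool" where
  "trivial_descendent G E Y \<longleftrightarrow>
    descendent G E Y \<and> (width G Y = 0 \<or> width G Y = diam G)"

definition nontrivial_descendent ::
  "'a pair_pre_digraph \<Rightarrow> (nat \<Rightarrow> 'a cmat) \<Rightarrow> 'a set \<Rightarrow> bool" where
  "nontrivial_descendent G E Y \<longleftrightarrow> descendent G E Y \<and> \<not> trivial_descendent G E Y"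


section \<open>Hermitean dual polar graphs\<close>

text \<open>
  Here \<open>'k\<close> is meant to be a field with \<open>l ^ 2\<close> elements, \<open>l\<close> a prime power, so that
  \<open>a \<mapsto> a ^ l\<close> is its automorphism of order 2. Semilinearity in the second argument follows
  from the two conditions.
\<close>

definition hermitean_form :: "nat \<Rightarrow> ('k::field ^ 'n \<Rightarrow> 'k ^ 'n \<Rightarrow> 'k) \<Rightarrow> bool" where
  "hermitean_form l h \<longleftrightarrow>
    (\<forall>y. Vector_Spaces.linear (*s) (*) (\<lambda>x. h x y)) \<and> (\<forall>x y. h y x = h x y ^ l)"

definition nondegenerate_form :: "('k::field ^ 'n \<Rightarrow> 'k ^ 'n \<Rightarrow> 'k) \<Rightarrow> bool" where
  "nondegenerate_form h \<longleftrightarrow> (\<forall>x. (\<forall>y. h x y = 0) \<longrightarrow> x = 0)"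

definition isotropic_subspace ::
  "('k::field ^ 'n \<Rightarrow> 'k ^ 'n \<Rightarrow> 'k) \<Rightarrow> ('k ^ 'n) set \<Rightarrow> bool" where
  "isotropic_subspace h W \<longleftrightarrow> vec.subspace W \<and> (\<forall>x\<in>W. \<forall>y\<in>W. h x y = 0)"

definition maximal_isotropic_subspace ::
  "('k::field ^ 'n \<Rightarrow> 'k ^ 'n \<Rightarrow> 'k) \<Rightarrow> ('k ^ 'n) set \<Rightarrow> bool" where
  "maximal_isotropic_subspace h W \<longleftrightarrow>
    isotropic_subspace h W \<and> (\<forall>W'. isotropic_subspace h W' \<and> W \<subseteq> W' \<longrightarrow> W' = W)"

text \<open>
  In the situation of interest (\<open>h\<close> nondegenerate Hermitean over a field with \<open>l ^ 2\<close> elements,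
  \<open>CARD('n) = 2 * d\<close>) every maximal isotropic subspace has dimension \<open>d\<close>, so the dimension
  condition excludes nothing.
\<close>

definition dual_polar_vertices ::
  "nat \<Rightarrow> ('k::field ^ 'n \<Rightarrow> 'k ^ 'n \<Rightarrow> 'k) \<Rightarrow> ('k ^ 'n) set set" where
  "dual_polar_vertices d h = {W. maximal_isotropic_subspace h W \<and> vec.dim W = d}"

definition dual_polar_graph ::
  "nat \<Rightarrow> ('k::field ^ 'n \<Rightarrow> 'k ^ 'n \<Rightarrow> 'k) \<Rightarrow> ('k ^ 'n) set pair_pre_digraph" where
  "dual_polar_graph d h =
    \<lparr> pverts = dual_polar_vertices d h,
      parcs = {(V, W). V \<in> dual_polar_vertices d h \<and> W \<in> dual_polar_vertices d h \<and>
                       vec.dim (V \<inter> W) = d - 1} \<rparr>"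

end

theory Submission
  imports Defs
begin

text \<open>
  Let \<open>Y\<close> be a descendent of width \<open>w\<close> and \<open>x \<in> Y\<close>. Since the quadratic forms of \<open>E i\<close> vanish at \<open>Y\<close> for
  \<open>i > d - w\<close>, every row of \<open>E d\<close> restricted to \<open>Y\<close> is orthogonal to all polynomials of degree less
  than \<open>w\<close> in the dual eigenvalue \<open>\<theta> (\<partial> x y)\<close>. As \<open>w + 1\<close> distances occur, this shows that a row of \<open>E d\<close>,
  summed over the neighbours of \<open>x\<close> in \<open>Y\<close>, gives \<open>- qnum q w\<close> times its entry at \<open>x\<close>. The same holds
  for the whole vertex set with \<open>w\<close> replaced by \<open>d\<close>.

  In a dual polar graph the neighbours of \<open>x\<close> split into disjoint cliques, one for each hyperplane of \<open>x\<close>.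
  Comparing the identity for the rows at the members of one clique shows that \<open>Y\<close> contains a clique
  as soon as it meets it. Subtracting the identities for \<open>Y\<close> and for the whole vertex set then forces
  the size of a clique to be \<open>\<beta>\<close>, whereas it is \<open>b 0 - b 1 = \<beta> + \<alpha> * (qnum q d - 1)\<close>.
\<close>

section \<open>Path-length distance\<close>

text \<open>Turns distances into least exponents of the arc relation, so that walks need not be
  handled as lists again. The condition \<open>x \<in> pverts G\<close> matters at length 0, where
  the relational power is the identity on the whole type.\<close>

lemma (in pair_graph) ex_awalk_length_iff_relpow:
  "(\<exists>p. awalk x p y \<and> length p = n) \<longleftrightarrow> x \<in> pverts G \<and> (x, y) \<in> parcs G ^^ n"
proof (induction n arbitrary: x)
  case 0
  show ?case by (auto simp: awalk_Nil_iff)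
next
  case (Suc n)
  have "(\<exists>p. awalk x p y \<and> length p = Suc n) \<longleftrightarrow>
      (\<exists>z. (x, z) \<in> parcs G \<and> (\<exists>p. awalk z p y \<and> length p = n))"
  proof safe
    fix z p assume "(x, z) \<in> parcs G" "awalk z p y" "n = length p"
    then show "\<exists>pa. awalk x pa y \<and> length pa = Suc (length p)"
      by (intro exI[of _ "(x, z) # p"]) (auto simp: awalk_Cons_iff)
  qed (fastforce simp: length_Suc_conv awalk_Cons_iff)
  also have "\<dots> \<longleftrightarrow> (\<exists>z. (x, z) \<in> parcs G \<and> (z, y) \<in> parcs G ^^ n)"
    using Suc.IH in_arcsD2 by blast
  also have "\<dots> \<longleftrightarrow> x \<in> pverts G \<and> (x, y) \<in> parcs G ^^ Suc n"
    by (meson in_arcsD1 relpow_Suc_D2 relpow_Suc_I2)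
  finally show ?case .
qed

locale connected_pair_graph = pair_graph G for G :: "'a pair_pre_digraph" +
  assumes connected: "Digraph_Component.connected (with_proj G)"
begin

abbreviation "X \<equiv> pverts G"
abbreviation partial_dist (\<open>\<partial>\<close>) where "\<partial> \<equiv> graph_dist G"

lemma arc_sym: "(x, y) \<in> parcs G \<Longrightarrow> (y, x) \<in> parcs G"
  using pair_sym_arcs by (auto simp: symmetric_def sym_def)

lemma relpow_sym: "(x, y) \<in> parcs G ^^ n \<Longrightarrow> (y, x) \<in> parcs G ^^ n"
proof (induction n arbitrary: y)
  case (Suc n)
  then obtain z where "(x, z) \<in> parcs G ^^ n" "(z, y) \<in> parcs G" by auto
  with Suc.IH arc_sym show ?case by (metis relpow_Suc_I2)
qed auto

lemma dist_eq_Least_relpow: "x \<in> X \<Longrightarrow> \<partial> x y = (LEAST n. (x, y) \<in> parcs G ^^ n)"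
  unfolding graph_dist_def using ex_awalk_length_iff_relpow by simp

lemma ex_relpow:
  assumes "x \<in> X" "y \<in> X" shows "\<exists>n. (x, y) \<in> parcs G ^^ n"
proof -
  \<comment> \<open>Connectedness speaks of the symmetric closure only; as the arcs are symmetric
    already, it yields directed walks.\<close>
  have "strongly_connected (with_proj G)"
    using connected pair_sym_arcs by (simp add: symmetric_connected_imp_strongly_connected)
  then have "(x, y) \<in> rtrancl_on (pverts G) (parcs G)"
    using assms by (auto simp: strongly_connected_def reachable_def)
  then have "(x, y) \<in> (parcs G)\<^sup>*"
    by (induction rule: rtrancl_on.induct) (auto intro: rtrancl_into_rtrancl)
  then show ?thesis by (simp add: rtrancl_power)
qed

lemma relpow_dist: "x \<in> X \<Longrightarrow> y \<in> X \<Longrightarrow> (x, y) \<in> parcs G ^^ \<partial> x y"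
  using LeastI_ex[OF ex_relpow] by (simp add: dist_eq_Least_relpow)

lemma dist_le: "x \<in> X \<Longrightarrow> (x, y) \<in> parcs G ^^ n \<Longrightarrow> \<partial> x y \<le> n"
  by (simp add: dist_eq_Least_relpow Least_le)

lemma dist_commute: "x \<in> X \<Longrightarrow> y \<in> X \<Longrightarrow> \<partial> x y = \<partial> y x"
  by (meson dist_le relpow_dist relpow_sym antisym)

lemma dist_eq_0_iff: "x \<in> X \<Longrightarrow> y \<in> X \<Longrightarrow> \<partial> x y = 0 \<longleftrightarrow> x = y"
  using relpow_dist[of x y] dist_le[of x y 0] by auto

lemma dist_self [simp]: "x \<in> X \<Longrightarrow> \<partial> x x = 0"
  by (simp add: dist_eq_0_iff)

lemma dist_eq_1_iff: "x \<in> X \<Longrightarrow> y \<in> X \<Longrightarrow> \<partial> x y = 1 \<longleftrightarrow> (x, y) \<in> parcs G"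
  using relpow_dist[of x y] dist_le[of x y 1] dist_eq_0_iff[of x y] no_loops'[of x y]
  by (auto simp: le_Suc_eq)

lemma dist_arc_le: 
  assumes "x \<in> X" "(y, z) \<in> parcs G" shows "\<partial> x z \<le> Suc (\<partial> x y)"
  using assms relpow_dist[of x y] in_arcsD1 by (intro dist_le) auto

lemma dist_pred:
  assumes "x \<in> X" "y \<in> X" "\<partial> x y = Suc i"
  obtains z where "(y, z) \<in> parcs G" "\<partial> x z = i"
proof -
  obtain z where z: "(x, z) \<in> parcs G ^^ i" "(z, y) \<in> parcs G"
    using relpow_dist[of x y] assms by auto
  have "\<partial> x z = i"
    using dist_le[OF _ z(1)] dist_arc_le[OF _ z(2), of x] assms by auto
  with z(2) that arc_sym show thesis by blast
qed

lemma dist_le_diam: "x \<in> X \<Longrightarrow> y \<in> X \<Longrightarrow> \<partial> x y \<le> diam G"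
proof -
  assume xy: "x \<in> X" "y \<in> X"
  have "{\<partial> x y | x y. x \<in> X \<and> y \<in> X} = (\<lambda>(x, y). \<partial> x y) ` (X \<times> X)" by auto
  then have "finite {\<partial> x y | x y. x \<in> X \<and> y \<in> X}" using pair_finite_verts by simp
  then show ?thesis unfolding diam_def using xy by (intro Max_ge) auto
qed

end

section \<open>The Bose--Mesner algebra\<close>

lemma mat_prod_assoc: "mat_prod G (mat_prod G M N) P = mat_prod G M (mat_prod G N P)"
  unfolding mat_prod_def
  by (intro ext, simp add: sum_distrib_left sum_distrib_right mult.assoc, subst sum.swap, rule refl)

lemma mat_prod_lincomb_right:
  "mat_prod G M (\<lambda>x y. u * N x y + v * N' x y) =
    (\<lambda>x y. u * mat_prod G M N x y + v * mat_prod G M N' x y)"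
  unfolding mat_prod_def
  by (intro ext) (simp add: sum_distrib_left sum.distrib[symmetric] algebra_simps)

lemma mat_prod_diff_right:
  "mat_prod G M (\<lambda>x y. N x y - N' x y) = (\<lambda>x y. mat_prod G M N x y - mat_prod G M N' x y)"
  unfolding mat_prod_def by (intro ext) (simp add: sum_subtractf right_diff_distrib)

lemma mat_prod_diff_left:
  "mat_prod G (\<lambda>x y. N x y - N' x y) M = (\<lambda>x y. mat_prod G N M x y - mat_prod G N' M x y)"
  unfolding mat_prod_def by (intro ext) (simp add: sum_subtractf left_diff_distrib)

lemma mat_prod_sum_left:
  "mat_prod G (\<lambda>x y. \<Sum>i\<in>I. f i * N i x y) M = (\<lambda>x y. \<Sum>i\<in>I. f i * mat_prod G (N i) M x y)"
  unfolding mat_prod_def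
  by (intro ext, simp add: sum_distrib_left sum_distrib_right mult.assoc, subst sum.swap, rule refl)

lemma mat_prod_sum_right:
  "mat_prod G M (\<lambda>x y. \<Sum>i\<in>I. f i * N i x y) = (\<lambda>x y. \<Sum>i\<in>I. f i * mat_prod G M (N i) x y)"
  unfolding mat_prod_def
  by (intro ext, simp add: sum_distrib_left mult.left_commute, subst sum.swap, rule refl)

lemma mat_prod_zero_right [simp]: "mat_prod G M (\<lambda>x y. 0) = (\<lambda>x y. 0)"
  by (simp add: mat_prod_def)

section \<open>Neighbour counts and closure of the Bose--Mesner algebra\<close>

locale distance_regular_graph = connected_pair_graph G for G :: "'a pair_pre_digraph" +
  fixes b c :: "nat \<Rightarrow> int"
  assumes intersection_numbers: "intersection_numbers G b c"
begin

lemma card_forward: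
  "x \<in> X \<Longrightarrow> y \<in> X \<Longrightarrow> \<partial> x y = i \<Longrightarrow> int (card {z. (y, z) \<in> parcs G \<and> \<partial> x z = Suc i}) = b i"
  using intersection_numbers by (auto simp: intersection_numbers_def)

lemma card_backward:
  "x \<in> X \<Longrightarrow> y \<in> X \<Longrightarrow> \<partial> x y = i \<Longrightarrow> int (card {z. (y, z) \<in> parcs G \<and> Suc (\<partial> x z) = i}) = c i"
  using intersection_numbers by (auto simp: intersection_numbers_def)

lemma finite_nbrs: "finite {z. (y, z) \<in> parcs G \<and> P z}"
  by (rule finite_subset[OF _ pair_finite_verts]) (auto dest: in_arcsD2)

lemma valency: "y \<in> X \<Longrightarrow> int (card {z. (y, z) \<in> parcs G}) = b 0"
proof -
  assume y: "y \<in> X"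
  have "{z. (y, z) \<in> parcs G} = {z. (y, z) \<in> parcs G \<and> \<partial> y z = Suc 0}"
    using y dist_eq_1_iff[of y] in_arcsD2[of y] by (intro Collect_cong) (metis One_nat_def)
  with card_forward[of y y 0] y show ?thesis by (simp add: dist_eq_0_iff)
qed

text \<open>An arc changes the distance from \<open>x\<close> by at most one, so the neighbours of
  \<open>y\<close> fall into three classes; their total is the valency \<open>b 0\<close>.\<close>

lemma card_level:
  assumes "x \<in> X" "y \<in> X" "\<partial> x y = i"
  shows "int (card {z. (y, z) \<in> parcs G \<and> \<partial> x z = i}) = b 0 - b i - c i"
proof -
  let ?F = "{z. (y, z) \<in> parcs G \<and> \<partial> x z = Suc i}"
    and ?B = "{z. (y, z) \<in> parcs G \<and> Suc (\<partial> x z) = i}"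
    and ?L = "{z. (y, z) \<in> parcs G \<and> \<partial> x z = i}"
  have "\<partial> x z = Suc i \<or> Suc (\<partial> x z) = i \<or> \<partial> x z = i" if "(y, z) \<in> parcs G" for z
  proof -
    have "\<partial> x z \<le> Suc i" "i \<le> Suc (\<partial> x z)"
      using dist_arc_le[OF assms(1) that] dist_arc_le[OF assms(1) arc_sym[OF that]]
      unfolding assms(3) by this
    then show ?thesis by linarith
  qed
  then have "{z. (y, z) \<in> parcs G} = ?F \<union> ?B \<union> ?L"
    by blast
  moreover have "card (?F \<union> ?B \<union> ?L) = card ?F + card ?B + card ?L"
  proof -
    have "card (?F \<union> ?B \<union> ?L) = card (?F \<union> ?B) + card ?L"
      by (intro card_Un_disjoint finite_UnI finite_nbrs) auto
    moreover have "card (?F \<union> ?B) = card ?F + card ?B"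
      by (intro card_Un_disjoint finite_nbrs) auto
    ultimately show ?thesis by simp
  qed
  ultimately have "card {z. (y, z) \<in> parcs G} = card ?F + card ?B + card ?L"
    by metis
  then show ?thesis
    using valency[OF assms(2)] card_forward[OF assms] card_backward[OF assms] by linarith
qed

text \<open>No distance exceeds the diameter, so the truncated sum loses nothing. Seen as functions
  of the distance, the members of the algebra are visibly symmetric and closed under linear
  combinations and conjugation.\<close>

lemma bose_mesner_iff:
  "M \<in> bose_mesner G \<longleftrightarrow> (\<exists>f. M = (\<lambda>x y. if x \<in> X \<and> y \<in> X then f (\<partial> x y) else 0))"
proof -
  have "(\<lambda>x y. \<Sum>i\<le>diam G. f i * dist_mat G i x y) =
      (\<lambda>x y. if x \<in> X \<and> y \<in> X then f (\<partial> x y) else 0)" for f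
    using dist_le_diam by (auto simp: dist_mat_def fun_eq_iff if_distrib cong: if_cong)
  then show ?thesis by (simp add: bose_mesner_def)
qed

lemma bose_mesnerE:
  assumes "M \<in> bose_mesner G"
  obtains f where "M = (\<lambda>x y. if x \<in> X \<and> y \<in> X then f (\<partial> x y) else 0)"
  using assms bose_mesner_iff by blast

lemma dist_mat_in_bose_mesner: "dist_mat G i \<in> bose_mesner G"
  unfolding bose_mesner_iff dist_mat_def
  by (rule exI[of _ "\<lambda>j. if j = i then 1 else 0"]) (auto simp: fun_eq_iff)

lemma bose_mesner_zero: "(\<lambda>x y. 0) \<in> bose_mesner G"
  unfolding bose_mesner_iff by (rule exI[of _ "\<lambda>j. 0"]) auto

lemma bose_mesner_lincomb:
  assumes "M \<in> bose_mesner G" "N \<in> bose_mesner G"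
  shows "(\<lambda>x y. u * M x y + v * N x y) \<in> bose_mesner G"
proof -
  obtain f where f: "M = (\<lambda>x y. if x \<in> X \<and> y \<in> X then f (\<partial> x y) else 0)"
    by (rule bose_mesnerE[OF assms(1)])
  obtain g where g: "N = (\<lambda>x y. if x \<in> X \<and> y \<in> X then g (\<partial> x y) else 0)"
    by (rule bose_mesnerE[OF assms(2)])
  show ?thesis
    unfolding f g bose_mesner_iff by (intro exI[of _ "\<lambda>j. u * f j + v * g j"]) (auto simp: fun_eq_iff)
qed

lemma bose_mesner_diff:
  "M \<in> bose_mesner G \<Longrightarrow> N \<in> bose_mesner G \<Longrightarrow> (\<lambda>x y. M x y - N x y) \<in> bose_mesner G"
  using bose_mesner_lincomb[of M N 1 "-1"] by simp

lemma bose_mesner_sum: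
  "(\<And>i. i \<in> I \<Longrightarrow> N i \<in> bose_mesner G) \<Longrightarrow> (\<lambda>x y. \<Sum>i\<in>I. f i * N i x y) \<in> bose_mesner G"
proof (induction I rule: infinite_finite_induct)
  case (insert i I)
  then show ?case
    using bose_mesner_lincomb[of "N i" "\<lambda>x y. \<Sum>i\<in>I. f i * N i x y" "f i" 1] by simp
qed (simp_all add: bose_mesner_zero)

lemma bose_mesner_cnj: "M \<in> bose_mesner G \<Longrightarrow> (\<lambda>x y. cnj (M x y)) \<in> bose_mesner G"
proof -
  assume "M \<in> bose_mesner G"
  then obtain f where "M = (\<lambda>x y. if x \<in> X \<and> y \<in> X then f (\<partial> x y) else 0)"
    by (rule bose_mesnerE)
  then show ?thesis
    unfolding bose_mesner_iff by (intro exI[of _ "\<lambda>j. cnj (f j)"]) (auto simp: fun_eq_iff)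
qed

lemma bose_mesner_sym: "M \<in> bose_mesner G \<Longrightarrow> M x y = M y x"
  by (auto elim!: bose_mesnerE simp: dist_commute)

lemma bose_mesner_outside: "M \<in> bose_mesner G \<Longrightarrow> x \<notin> X \<or> y \<notin> X \<Longrightarrow> M x y = 0"
  by (auto elim!: bose_mesnerE)

text \<open>The entry at \<open>x\<close>, \<open>y\<close> counts the neighbours of
  \<open>y\<close> at distance \<open>i\<close> from \<open>x\<close>. This is an intersection
  number, and it is zero unless \<open>\<partial> x y\<close> and \<open>i\<close> differ by at most
  one.\<close>

lemma dist_mat_mult_dist_mat_1:
  "mat_prod G (dist_mat G i) (dist_mat G 1) =
    (\<lambda>x y. (if i = 0 then 0 else of_int (b (i - 1)) * dist_mat G (i - 1) x y)
      + of_int (b 0 - b i - c i) * dist_mat G i x y + of_int (c (Suc i)) * dist_mat G (Suc i) x y)"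
proof (intro ext)
  fix x y
  show "mat_prod G (dist_mat G i) (dist_mat G 1) x y =
    (if i = 0 then 0 else of_int (b (i - 1)) * dist_mat G (i - 1) x y)
      + of_int (b 0 - b i - c i) * dist_mat G i x y + of_int (c (Suc i)) * dist_mat G (Suc i) x y"
  proof (cases "x \<in> X \<and> y \<in> X")
    case True
    let ?S = "{z. (y, z) \<in> parcs G \<and> \<partial> x z = i}"
    have S: "?S = {z \<in> X. \<partial> x z = i \<and> \<partial> z y = 1}"
    proof safe
      fix z assume "(y, z) \<in> parcs G"
      then show "z \<in> X" "\<partial> z y = 1" using True dist_eq_1_iff[of z y] arc_sym in_arcsD2 by simp_all
    next
      fix z assume "z \<in> X" "\<partial> z y = 1"
      then show "(y, z) \<in> parcs G" using True dist_eq_1_iff[of z y] arc_sym by simp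
    qed
    have "mat_prod G (dist_mat G i) (dist_mat G 1) x y = (\<Sum>z\<in>X. if \<partial> x z = i \<and> \<partial> z y = 1 then 1 else 0)"
      unfolding mat_prod_def dist_mat_def using True by (intro sum.cong) auto
    also have "\<dots> = of_int (int (card ?S))"
      unfolding S using pair_finite_verts by (simp add: sum.If_cases Int_def)
    finally have eq: "mat_prod G (dist_mat G i) (dist_mat G 1) x y = of_int (int (card ?S))" .
    have "\<partial> x y = i \<or> \<partial> x y = Suc i \<or> Suc (\<partial> x y) = i \<or> ?S = {}"
      using dist_arc_le[of x y] dist_arc_le[OF _ arc_sym, of x y] True by (fastforce simp: le_Suc_eq)
    then consider "\<partial> x y = i" | "\<partial> x y = Suc i" | "Suc (\<partial> x y) = i"
      | "?S = {}" "\<partial> x y \<noteq> i" "\<partial> x y \<noteq> Suc i" "Suc (\<partial> x y) \<noteq> i" by blast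
    then show ?thesis
    proof cases
      case 1
      have "int (card ?S) = b 0 - b i - c i" using True 1 card_level[of x y i] by simp
      then show ?thesis unfolding eq using True 1 by (auto simp: dist_mat_def)
    next
      case 2
      have "int (card ?S) = c (Suc i)" using True 2 card_backward[of x y "Suc i"] by simp
      then show ?thesis unfolding eq using True 2 by (simp add: dist_mat_def)
    next
      case 3
      have "int (card ?S) = b (i - 1)" using True 3 card_forward[of x y "\<partial> x y"] by auto
      then show ?thesis unfolding eq using True 3 by (simp add: dist_mat_def)
    next
      case 4
      have "mat_prod G (dist_mat G i) (dist_mat G 1) x y = 0" unfolding eq 4(1) by simp
      then show ?thesis using True 4(2-4) by (auto simp: dist_mat_def)
    qed
  qed (auto simp: dist_mat_def mat_prod_def)
qed

text \<open>Allows the three-term recurrence to be solved for the next distance matrix. A pair at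
  distance \<open>Suc i\<close> has a predecessor on a shortest path; if no such pair exists,
  \<open>c (Suc i)\<close> is unconstrained but the matrix is zero.\<close>

lemma c_nonzero: "dist_mat G (Suc i) = (\<lambda>x y. 0) \<or> c (Suc i) \<noteq> 0"
proof (cases "\<exists>x\<in>X. \<exists>y\<in>X. \<partial> x y = Suc i")
  case True
  then obtain x y where xy: "x \<in> X" "y \<in> X" "\<partial> x y = Suc i" by blast
  then obtain z where "(y, z) \<in> parcs G" "\<partial> x z = i" by (rule dist_pred)
  then have "card {z. (y, z) \<in> parcs G \<and> Suc (\<partial> x z) = Suc i} \<noteq> 0"
    using finite_nbrs[of y] by auto
  with card_backward[OF xy] show ?thesis by linarith
qed (auto simp: dist_mat_def fun_eq_iff)

lemma dist_mat_0: "M \<in> bose_mesner G \<Longrightarrow> mat_prod G M (dist_mat G 0) = M"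
proof (intro ext)
  fix x y assume M: "M \<in> bose_mesner G"
  have "mat_prod G M (dist_mat G 0) x y = (\<Sum>z\<in>X. if z = y then M x y else 0)"
    unfolding mat_prod_def dist_mat_def
    using dist_eq_0_iff[of _ y] bose_mesner_outside[OF M, of x y]
    by (intro sum.cong refl) auto
  then show "mat_prod G M (dist_mat G 0) x y = M x y"
    using pair_finite_verts M bose_mesner_outside by auto
qed

lemma bose_mesner_mult_dist_mat_1:
  assumes "M \<in> bose_mesner G" shows "mat_prod G M (dist_mat G 1) \<in> bose_mesner G"
proof -
  have "mat_prod G (dist_mat G i) (dist_mat G 1) \<in> bose_mesner G" for i
  proof -
    have "(\<lambda>x y. if i = 0 then 0 else of_int (b (i - 1)) * dist_mat G (i - 1) x y) \<in> bose_mesner G"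
      using bose_mesner_lincomb[OF dist_mat_in_bose_mesner bose_mesner_zero, of _ _ 0]
      by (cases "i = 0") (simp_all add: bose_mesner_zero)
    then show ?thesis
      unfolding dist_mat_mult_dist_mat_1
      using bose_mesner_lincomb[OF _ bose_mesner_lincomb[OF dist_mat_in_bose_mesner dist_mat_in_bose_mesner],
          of _ 1 1] by (simp add: add.assoc)
  qed
  moreover obtain f where "M = (\<lambda>x y. \<Sum>i\<le>diam G. f i * dist_mat G i x y)"
    using assms unfolding bose_mesner_def by blast
  ultimately show ?thesis by (simp add: mat_prod_sum_left bose_mesner_sum)
qed

text \<open>The recurrence, solved for the distance matrix of index \<open>Suc j\<close>, involves
  only those of index \<open>j\<close> and \<open>j - 1\<close> and the product of the former with
  \<open>dist_mat G 1\<close>, and right multiplication by \<open>dist_mat G 1\<close> preserves the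
  algebra.\<close>

lemma bose_mesner_mult_dist_mat:
  "M \<in> bose_mesner G \<Longrightarrow> mat_prod G M (dist_mat G i) \<in> bose_mesner G"
proof (induction i arbitrary: M rule: less_induct)
  case (less i)
  show ?case
  proof (cases i)
    case 0
    with less.prems show ?thesis by (simp add: dist_mat_0)
  next
    case (Suc j)
    show ?thesis
    proof (cases "c (Suc j) = 0")
      case True
      with c_nonzero[of j] Suc show ?thesis by (simp add: bose_mesner_zero)
    next
      case False
      define s where "s = complex_of_int (c (Suc j))"
      define B where "B = (if j = 0 then (\<lambda>x y. 0) else dist_mat G (j - 1))"
      have "s \<noteq> 0" using False by (simp add: s_def)
      have "mat_prod G M B \<in> bose_mesner G"
        unfolding B_def using less Suc by (simp add: bose_mesner_zero)
      moreover have "mat_prod G M (dist_mat G j) \<in> bose_mesner G"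
        using less Suc by simp
      moreover have "mat_prod G M (mat_prod G (dist_mat G j) (dist_mat G 1)) \<in> bose_mesner G"
        using less Suc bose_mesner_mult_dist_mat_1 by (simp flip: mat_prod_assoc)
      moreover have "dist_mat G i = (\<lambda>x y. (1 / s) * mat_prod G (dist_mat G j) (dist_mat G 1) x y +
          1 * ((- of_int (b 0 - b j - c j) / s) * dist_mat G j x y + (- of_int (b (j - 1)) / s) * B x y))"
        unfolding dist_mat_mult_dist_mat_1 Suc B_def using \<open>s \<noteq> 0\<close>
        by (auto simp: fun_eq_iff field_simps s_def)
      ultimately show ?thesis
        by (simp only: mat_prod_lincomb_right bose_mesner_lincomb)
    qed
  qed
qed

lemma bose_mesner_mult:
  assumes "M \<in> bose_mesner G" "N \<in> bose_mesner G" shows "mat_prod G M N \<in> bose_mesner G"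
proof -
  obtain f where "N = (\<lambda>x y. \<Sum>i\<le>diam G. f i * dist_mat G i x y)"
    using assms unfolding bose_mesner_def by blast
  with assms show ?thesis
    by (simp add: mat_prod_sum_right bose_mesner_sum bose_mesner_mult_dist_mat)
qed

text \<open>Members of the algebra and their products are symmetric, and the transpose of
  \<open>M N\<close> is then \<open>N M\<close>.\<close>

lemma bose_mesner_commute:
  assumes "M \<in> bose_mesner G" "N \<in> bose_mesner G" shows "mat_prod G M N = mat_prod G N M"
proof (intro ext)
  fix x y
  have "mat_prod G M N x y = mat_prod G M N y x"
    using assms bose_mesner_mult bose_mesner_sym by blast
  also have "\<dots> = mat_prod G N M x y"
    unfolding mat_prod_def using bose_mesner_sym[OF assms(1)] bose_mesner_sym[OF assms(2)]
    by (intro sum.cong) (auto simp: mult.commute)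
  finally show "mat_prod G M N x y = mat_prod G N M x y" .
qed

text \<open>Idempotents are not assumed Hermitean, so reality has to be derived, from commutativity
  and closure under conjugation. It makes the sums of squares in later arguments
  nonnegative.\<close>

lemma idempotent_real:
  assumes "bm_idempotent G M" shows "cnj (M x y) = M x y"
proof -
  have M: "M \<in> bose_mesner G" "mat_prod G M M = M"
    using assms by (auto simp: bm_idempotent_def)
  define N where "N = (\<lambda>x y. cnj (M x y))"
  have N: "N \<in> bose_mesner G" unfolding N_def by (rule bose_mesner_cnj[OF M(1)])
  have N_idem: "mat_prod G N N = N"
    unfolding N_def using M(2) by (auto simp: mat_prod_def fun_eq_iff simp flip: cnj_sum complex_cnj_mult)
  define P where "P = mat_prod G N M"
  have P: "P \<in> bose_mesner G" "P = mat_prod G M N"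
    unfolding P_def using M N bose_mesner_mult bose_mesner_commute by auto
  have NP: "mat_prod G N P = P" unfolding P_def by (simp add: N_idem flip: mat_prod_assoc)
  have MP: "mat_prod G M P = P" unfolding P(2) by (simp add: M(2) flip: mat_prod_assoc)
  have PM: "mat_prod G P M = P" using MP bose_mesner_commute[OF P(1) M(1)] by simp
  have "mat_prod G (mat_prod G N M) P = P" by (simp add: mat_prod_assoc MP NP)
  then have PP: "mat_prod G P P = P" by (simp add: P_def)
  \<comment> \<open>\<open>T\<^sup>* T = 0\<close>, so \<open>M\<close> equals the Hermitean matrix \<open>M\<^sup>* M = P\<close>.\<close>
  define T where "T = (\<lambda>x y. M x y - P x y)"
  have cnjP: "cnj (P x y) = P x y" for x y
  proof -
    have "cnj (P x y) = mat_prod G M N x y"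
      by (simp add: P_def N_def mat_prod_def)
    then show ?thesis by (simp flip: P(2))
  qed
  have T: "T \<in> bose_mesner G" unfolding T_def using M P bose_mesner_diff by blast
  have "mat_prod G (\<lambda>x y. cnj (T x y)) T = mat_prod G (\<lambda>x y. N x y - P x y) (\<lambda>x y. M x y - P x y)"
    by (simp add: T_def N_def cnjP)
  also have "\<dots> = (\<lambda>x y. 0)"
    by (simp add: mat_prod_diff_left mat_prod_diff_right NP PM PP P_def[symmetric])
  finally have "mat_prod G (\<lambda>x y. cnj (T x y)) T y y = 0" for y by (simp add: fun_eq_iff)
  moreover have "mat_prod G (\<lambda>x y. cnj (T x y)) T y y = of_real (\<Sum>z\<in>X. (cmod (T z y))\<^sup>2)" for y
  proof -
    have "cnj (T y z) * T z y = of_real ((cmod (T z y))\<^sup>2)" for z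
      using bose_mesner_sym[OF T, of y z] by (metis complex_norm_square mult.commute of_real_power)
    then show ?thesis by (simp add: mat_prod_def)
  qed
  ultimately have "(\<Sum>z\<in>X. (cmod (T z y))\<^sup>2) = 0" for y by (metis of_real_eq_0_iff)
  then have "T z y = 0" if "z \<in> X" for z y
    using that pair_finite_verts by (simp add: sum_nonneg_eq_0_iff)
  then have "T x y = 0" for x y using bose_mesner_outside[OF T] by blast
  then have "M x y = P x y" for x y by (simp add: T_def)
  then show ?thesis using cnjP by simp
qed

text \<open>The identity \<open>E = E F + (E - E F)\<close> splits \<open>E\<close> into orthogonal
  idempotents of the algebra. If \<open>E F\<close> is nonzero, primitivity of \<open>E\<close>
  leaves only \<open>E F = E\<close>; exchanging the roles gives \<open>E F = F\<close>.\<close>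

lemma primitive_idempotents_orthogonal:
  assumes "primitive_idempotent G E" "primitive_idempotent G F" "E \<noteq> F"
  shows "mat_prod G E F = (\<lambda>x y. 0)"
proof (rule ccontr)
  assume nz: "mat_prod G E F \<noteq> (\<lambda>x y. 0)"
  have absorb: "mat_prod G E F = E"
    if E: "primitive_idempotent G E" and F: "primitive_idempotent G F"
      and nz: "mat_prod G E F \<noteq> (\<lambda>x y. 0)" for E F
  proof (rule ccontr)
    assume ne: "mat_prod G E F \<noteq> E"
    define P where "P = mat_prod G E F"
    define R where "R = (\<lambda>x y. E x y - P x y)"
    have bm: "E \<in> bose_mesner G" "F \<in> bose_mesner G" and idem: "mat_prod G E E = E" "mat_prod G F F = F"
      using E F by (auto simp: primitive_idempotent_def bm_idempotent_def)
    have P: "P \<in> bose_mesner G" unfolding P_def using bm bose_mesner_mult by blast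
    have EP: "mat_prod G E P = P" unfolding P_def by (simp add: idem flip: mat_prod_assoc)
    have PE: "mat_prod G P E = P" using EP bose_mesner_commute[OF P bm(1)] by simp
    have PF: "mat_prod G P F = P" unfolding P_def by (simp add: idem mat_prod_assoc)
    have "mat_prod G P (mat_prod G E F) = P" by (simp add: PE PF flip: mat_prod_assoc)
    then have PP: "mat_prod G P P = P" by (simp add: P_def)
    have R: "R \<in> bose_mesner G" unfolding R_def using bm P bose_mesner_diff by blast
    have "mat_prod G R R = R" "mat_prod G P R = (\<lambda>x y. 0)" "mat_prod G R P = (\<lambda>x y. 0)"
      unfolding R_def by (simp_all add: mat_prod_diff_left mat_prod_diff_right EP PE PP idem)
    moreover have "E = (\<lambda>x y. P x y + R x y)" "R \<noteq> (\<lambda>x y. 0)" "P \<noteq> (\<lambda>x y. 0)"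
      using ne nz unfolding R_def P_def by (simp_all add: fun_eq_iff) metis
    moreover have "bm_idempotent G P" "bm_idempotent G R"
      using P R PP \<open>mat_prod G R R = R\<close> by (simp_all add: bm_idempotent_def)
    ultimately show False
      using E unfolding primitive_idempotent_def by blast
  qed
  have comm: "mat_prod G F E = mat_prod G E F"
    using assms by (intro bose_mesner_commute) (auto simp: primitive_idempotent_def bm_idempotent_def)
  have "E = F"
    using absorb[OF assms(1,2) nz] absorb[OF assms(2,1)] nz unfolding comm by simp
  with assms(3) show False by simp
qed

end

section \<open>Descendents of Q-polynomial graphs\<close>

text \<open>A linear functional that kills the powers below \<open>N\<close> kills all polynomials
  of degree below \<open>N\<close>. The spare factor \<open>t y ^ k\<close> makes the induction
  hypothesis apply to both terms when a linear factor is expanded.\<close>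

lemma sum_mult_prod_eq_0:
  fixes f t :: "'a \<Rightarrow> 'b::comm_ring_1"
  assumes "finite J" and moments: "\<And>k. k < N \<Longrightarrow> (\<Sum>y\<in>Y. f y * t y ^ k) = 0"
    and "k + card J < N"
  shows "(\<Sum>y\<in>Y. f y * t y ^ k * (\<Prod>j\<in>J. t y - r j)) = 0"
  using assms(1,3)
proof (induction J arbitrary: k)
  case empty
  then show ?case using moments by simp
next
  case (insert i J)
  let ?P = "\<lambda>y. \<Prod>j\<in>J. t y - r j"
  have "(\<Sum>y\<in>Y. f y * t y ^ k * (\<Prod>j\<in>insert i J. t y - r j)) =
      (\<Sum>y\<in>Y. f y * t y ^ Suc k * ?P y) - r i * (\<Sum>y\<in>Y. f y * t y ^ k * ?P y)"
    using insert.hyps by (simp add: sum_distrib_left sum_subtractf[symmetric] algebra_simps)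
  also have "\<dots> = 0" using insert.IH[of k] insert.IH[of "Suc k"] insert.prems insert.hyps by simp
  finally show ?case .
qed

section \<open>Primitive idempotents of a Q-polynomial ordering\<close>

locale q_polynomial_graph = distance_regular_graph G b c
  for G :: "'a pair_pre_digraph" and b c +
  fixes E :: "nat \<Rightarrow> 'a cmat"
  assumes Q_polynomial: "Q_polynomial G E"
begin

abbreviation "d \<equiv> diam G"
abbreviation "n \<equiv> card X"

lemma E_primitive: "i \<le> d \<Longrightarrow> primitive_idempotent G (E i)"
  using Q_polynomial by (auto simp: Q_polynomial_def bij_betw_def)

lemma E_in_bose_mesner: "i \<le> d \<Longrightarrow> E i \<in> bose_mesner G"
  and E_idempotent: "i \<le> d \<Longrightarrow> mat_prod G (E i) (E i) = E i"
  and E_nonzero: "i \<le> d \<Longrightarrow> E i \<noteq> (\<lambda>x y. 0)"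
  using E_primitive[of i] by (auto simp: primitive_idempotent_def bm_idempotent_def)

lemma E_sym: "i \<le> d \<Longrightarrow> E i x y = E i y x"
  using E_in_bose_mesner bose_mesner_sym by blast

lemma E_real: "i \<le> d \<Longrightarrow> cnj (E i x y) = E i x y"
  using E_primitive[of i] idempotent_real by (auto simp: primitive_idempotent_def)

lemma E_orthogonal:
  assumes "i \<le> d" "j \<le> d" "i \<noteq> j"
  shows "mat_prod G (E i) (E j) = (\<lambda>x y. 0)"
proof -
  have "inj_on E {..d}" using Q_polynomial by (auto simp: Q_polynomial_def bij_betw_def)
  then have "E i \<noteq> E j" using assms by (auto dest: inj_onD)
  then show ?thesis using primitive_idempotents_orthogonal E_primitive assms by blast
qed

lemma E_mult:
  assumes "i \<le> d" "j \<le> d"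
  shows "(\<Sum>z\<in>X. E i x z * E j z y) = (if i = j then E i x y else 0)"
proof -
  have "mat_prod G (E i) (E j) x y = (if i = j then E i x y else 0)"
    using assms E_orthogonal E_idempotent by auto
  then show ?thesis by (simp add: mat_prod_def)
qed

lemma verts_nonempty: "n \<noteq> 0"
proof
  assume "n = 0"
  then have "X = {}" using pair_finite_verts by simp
  then have "E 0 = (\<lambda>x y. 0)"
    using bose_mesner_outside[OF E_in_bose_mesner[of 0]] by (simp add: fun_eq_iff)
  then show False using E_nonzero[of 0] by simp
qed

text \<open>By idempotency, symmetry and reality a diagonal entry is the squared length of its row,
  and all diagonal entries are equal; if one were zero, the whole matrix would be.\<close>

lemma E_diagonal_nonzero:
  assumes "i \<le> d" "x \<in> X" shows "E i x x \<noteq> 0"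
proof
  assume 0: "E i x x = 0"
  obtain f where f: "E i = (\<lambda>x y. if x \<in> X \<and> y \<in> X then f (\<partial> x y) else 0)"
    using E_in_bose_mesner[OF assms(1)] by (rule bose_mesnerE)
  have "E i y z = 0" if "y \<in> X" "z \<in> X" for y z
  proof -
    have "f 0 = 0" using 0 assms by (simp add: f)
    then have "E i y y = 0" using that by (simp add: f)
    then have "0 = (\<Sum>z\<in>X. E i y z * E i z y)" using assms by (simp add: E_mult)
    also have "\<dots> = (\<Sum>z\<in>X. of_real ((cmod (E i y z))\<^sup>2))"
      using E_sym[OF assms(1), of _ y] E_real[OF assms(1), of y]
      by (intro sum.cong refl) (metis complex_norm_square of_real_power)
    finally have "complex_of_real (\<Sum>z\<in>X. (cmod (E i y z))\<^sup>2) = 0" by simp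
    then have "(\<Sum>z\<in>X. (cmod (E i y z))\<^sup>2) = 0" by (simp only: of_real_eq_0_iff)
    then show ?thesis
      using that pair_finite_verts by (subst (asm) sum_nonneg_eq_0_iff) auto
  qed
  then have "E i = (\<lambda>x y. 0)" by (auto simp: f fun_eq_iff)
  with E_nonzero[OF assms(1)] show False by contradiction
qed

lemma E_0: "x \<in> X \<Longrightarrow> y \<in> X \<Longrightarrow> E 0 x y = 1 / of_nat n"
  using Q_polynomial by (auto simp: Q_polynomial_def all_ones_def)

text \<open>Equality is required at vertices only: an entrywise power with exponent 0 has entries 1
  outside \<open>X\<close> as well, where every \<open>E j\<close> vanishes.\<close>

definition span_E :: "nat set \<Rightarrow> 'a cmat set" where
  "span_E I = {M. \<exists>g. \<forall>x\<in>X. \<forall>y\<in>X. M x y = (\<Sum>j\<in>I. g j * E j x y)}"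

lemma span_E_mono:
  assumes "M \<in> span_E I" "I \<subseteq> J" "finite J" shows "M \<in> span_E J"
proof -
  obtain g where g: "\<forall>x\<in>X. \<forall>y\<in>X. M x y = (\<Sum>j\<in>I. g j * E j x y)"
    using assms(1) by (auto simp: span_E_def)
  have "(\<Sum>j\<in>I. g j * E j x y) = (\<Sum>j\<in>J. (if j \<in> I then g j else 0) * E j x y)" for x y
    using assms by (intro sum.mono_neutral_cong_left) auto
  with g show ?thesis unfolding span_E_def by auto
qed

lemma span_E_lincomb:
  assumes "M \<in> span_E I" "N \<in> span_E I"
  shows "(\<lambda>x y. u * M x y + v * N x y) \<in> span_E I"
proof -
  obtain g where g: "\<forall>x\<in>X. \<forall>y\<in>X. M x y = (\<Sum>j\<in>I. g j * E j x y)"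
    using assms(1) by (auto simp: span_E_def)
  obtain h where h: "\<forall>x\<in>X. \<forall>y\<in>X. N x y = (\<Sum>j\<in>I. h j * E j x y)"
    using assms(2) by (auto simp: span_E_def)
  have "\<forall>x\<in>X. \<forall>y\<in>X. u * M x y + v * N x y = (\<Sum>j\<in>I. (u * g j + v * h j) * E j x y)"
    using g h by (simp add: sum_distrib_left sum.distrib algebra_simps)
  then show ?thesis unfolding span_E_def by (intro CollectI exI) assumption
qed

lemma span_E_sum:
  "(\<And>i. i \<in> K \<Longrightarrow> N i \<in> span_E I) \<Longrightarrow> (\<lambda>x y. \<Sum>i\<in>K. f i * N i x y) \<in> span_E I"
proof (induction K rule: infinite_finite_induct)
  case (insert i K)
  then show ?case
    using span_E_lincomb[of "N i" I "\<lambda>x y. \<Sum>i\<in>K. f i * N i x y" "f i" 1] by simp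
qed (auto simp: span_E_def intro!: exI[of _ "\<lambda>_. 0"])

lemma E_in_span_E: "j \<in> I \<Longrightarrow> finite I \<Longrightarrow> E j \<in> span_E I"
  unfolding span_E_def
  by (auto intro!: exI[of _ "\<lambda>i. if i = j then 1 else 0"] simp: if_distrib[of "\<lambda>u. u * _"] cong: if_cong)

lemma span_E_cong: "M \<in> span_E I \<Longrightarrow> (\<And>x y. x \<in> X \<Longrightarrow> y \<in> X \<Longrightarrow> M x y = N x y) \<Longrightarrow> N \<in> span_E I"
  unfolding span_E_def by simp

section \<open>Entrywise products with \<open>E 1\<close> and \<open>E d\<close>\<close>

lemma obtain_recurrence:
  obtains as bs cs :: "nat \<Rightarrow> complex" where
    "\<And>i. 1 \<le> i \<Longrightarrow> i \<le> d \<Longrightarrow> cs i \<noteq> 0"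
    "\<And>i x y. i \<le> d \<Longrightarrow> E 1 x y * E i x y =
          ((if i = 0 then 0 else bs (i - 1) * E (i - 1) x y) + as i * E i x y
             + (if i = d then 0 else cs (i + 1) * E (i + 1) x y)) / of_nat n"
proof -
  obtain as bs cs :: "nat \<Rightarrow> complex" where
    1: "\<forall>i\<in>{1..d}. bs (i - 1) * cs i \<noteq> 0" and
    2: "\<forall>i\<le>d. \<forall>x y. E 1 x y * E i x y =
          ((if i = 0 then 0 else bs (i - 1) * E (i - 1) x y) + as i * E i x y
             + (if i = d then 0 else cs (i + 1) * E (i + 1) x y)) / of_nat n"
    using Q_polynomial unfolding Q_polynomial_def by blast
  show thesis
    by (rule that[of cs bs as]) (use 1 2 in auto)
qed

lemma E_1_Schur_E:
  assumes "j \<le> d" "{j - 1..j + 1} \<inter> {..d} \<subseteq> J" "finite J"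
  shows "(\<lambda>x y. E 1 x y * E j x y) \<in> span_E J"
proof -
  obtain as bs cs where rec: "\<And>i x y. i \<le> d \<Longrightarrow> E 1 x y * E i x y =
          ((if i = 0 then 0 else bs (i - 1) * E (i - 1) x y) + as i * E i x y
             + (if i = d then 0 else cs (i + 1) * E (i + 1) x y)) / of_nat n"
    using obtain_recurrence by metis
  define K where "K = (if j = 0 then {} else {j - 1}) \<union> {j} \<union> (if j = d then {} else {Suc j})"
  define g where "g i = (if i = j then as j else if Suc i = j then bs i else cs i) / of_nat n" for i
  have "(\<Sum>i\<in>K. g i * E i x y) = E 1 x y * E j x y" for x y
    unfolding rec[OF assms(1)] K_def g_def by (cases j) (auto simp: add_divide_distrib)
  moreover have "(\<lambda>x y. \<Sum>i\<in>K. g i * E i x y) \<in> span_E J"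
    using assms by (intro span_E_sum E_in_span_E) (auto simp: K_def split: if_splits)
  ultimately show ?thesis by simp
qed

lemma E_1_Schur_span:
  assumes "M \<in> span_E I" "I \<subseteq> {..d}" "\<And>j. j \<in> I \<Longrightarrow> {j - 1..j + 1} \<inter> {..d} \<subseteq> J" "finite J"
  shows "(\<lambda>x y. E 1 x y * M x y) \<in> span_E J"
proof -
  obtain g where g: "\<forall>x\<in>X. \<forall>y\<in>X. M x y = (\<Sum>j\<in>I. g j * E j x y)"
    using assms(1) by (auto simp: span_E_def)
  have "(\<lambda>x y. \<Sum>j\<in>I. g j * (E 1 x y * E j x y)) \<in> span_E J"
    using assms by (intro span_E_sum E_1_Schur_E) auto
  then show ?thesis
    by (rule span_E_cong) (simp add: g sum_distrib_left mult.left_commute)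
qed

text \<open>Each entrywise factor \<open>E 1\<close> raises the largest index by at most one,
  starting from the all-ones matrix, which is \<open>n\<close> times \<open>E 0\<close>.\<close>

lemma E_1_Schur_power: "k \<le> d \<Longrightarrow> (\<lambda>x y. E 1 x y ^ k) \<in> span_E {..k}"
proof (induction k)
  case 0
  have "(\<lambda>x y. \<Sum>i\<in>{0}. of_nat n * E i x y) \<in> span_E {..0}"
    by (intro span_E_sum E_in_span_E) auto
  then show ?case by (rule span_E_cong) (use verts_nonempty in \<open>auto simp: E_0\<close>)
next
  case (Suc k)
  then show ?case
    using E_1_Schur_span[of "\<lambda>x y. E 1 x y ^ k" "{..k}" "{..Suc k}"] by auto
qed

text \<open>An instance of the triangle inequality for Krein parameters. The recurrence can be
  solved for \<open>E j\<close> because the coefficients \<open>cs\<close> are nonzero; this leads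
  back to smaller indices, and the one extra factor \<open>E 1\<close> lowers the bottom index by at
  most one.\<close>

lemma E_d_Schur_E: "j \<le> d \<Longrightarrow> (\<lambda>x y. E d x y * E j x y) \<in> span_E {d - j..d}"
proof (induction j rule: less_induct)
  case (less j)
  obtain as bs cs where nz: "\<And>i. 1 \<le> i \<Longrightarrow> i \<le> d \<Longrightarrow> cs i \<noteq> 0"
    and rec: "\<And>i x y. i \<le> d \<Longrightarrow> E 1 x y * E i x y =
          ((if i = 0 then 0 else bs (i - 1) * E (i - 1) x y) + as i * E i x y
             + (if i = d then 0 else cs (i + 1) * E (i + 1) x y)) / of_nat n"
    using obtain_recurrence by metis
  show ?case
  proof (cases j)
    case 0
    have "(\<lambda>x y. \<Sum>i\<in>{d}. (1 / of_nat n) * E i x y) \<in> span_E {d - j..d}"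
      by (intro span_E_sum E_in_span_E) auto
    then show ?thesis by (rule span_E_cong) (auto simp: 0 E_0)
  next
    case (Suc i)
    define s where "s = cs (Suc i)"
    \<comment> \<open>The term with \<open>E (i - 1)\<close>. It is absent at \<open>i = 0\<close>,
      where truncated subtraction would produce \<open>E 0\<close>.\<close>
    define B where "B = (if i = 0 then (\<lambda>x y. 0) else (\<lambda>x y. E d x y * E (i - 1) x y))"
    have "s \<noteq> 0" using nz less.prems Suc by (simp add: s_def)
    have IH: "(\<lambda>x y. E d x y * E i x y) \<in> span_E {d - i..d}"
      using less Suc by simp
    have "(\<lambda>x y. E 1 x y * (E d x y * E i x y)) \<in> span_E {d - j..d}"
      using less.prems Suc by (intro E_1_Schur_span[OF IH]) auto
    moreover have "(\<lambda>x y. E d x y * E i x y) \<in> span_E {d - j..d}"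
      by (rule span_E_mono[OF IH]) (use Suc in auto)
    moreover have "B \<in> span_E {d - j..d}"
    proof (cases "i = 0")
      case True
      then show ?thesis by (auto simp: B_def span_E_def intro!: exI[of _ "\<lambda>_. 0"])
    next
      case False
      have "(\<lambda>x y. E d x y * E (i - 1) x y) \<in> span_E {d - (i - 1)..d}"
        using Suc less.prems by (intro less.IH) auto
      then have "(\<lambda>x y. E d x y * E (i - 1) x y) \<in> span_E {d - j..d}"
        by (rule span_E_mono) (use Suc in auto)
      then show ?thesis using False by (simp add: B_def)
    qed
    ultimately have "(\<lambda>x y. (of_nat n / s) * (E 1 x y * (E d x y * E i x y)) +
        1 * ((- as i / s) * (E d x y * E i x y) + (- bs (i - 1) / s) * B x y)) \<in> span_E {d - j..d}"
      by (intro span_E_lincomb)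
    then show ?thesis
    proof (rule span_E_cong)
      fix x y
      have "E 1 x y * E i x y = ((if i = 0 then 0 else bs (i - 1) * E (i - 1) x y) + as i * E i x y + s * E j x y) / of_nat n"
        using rec[of i x y] less.prems Suc by (simp add: s_def)
      then have *: "s * E j x y = of_nat n * (E 1 x y * E i x y) - (if i = 0 then 0 else bs (i - 1) * E (i - 1) x y) - as i * E i x y"
        using verts_nonempty by (simp add: field_simps)
      have "s * ((of_nat n / s) * (E 1 x y * (E d x y * E i x y)) +
        1 * ((- as i / s) * (E d x y * E i x y) + (- bs (i - 1) / s) * B x y)) =
        E d x y * (of_nat n * (E 1 x y * E i x y) - (if i = 0 then 0 else bs (i - 1) * E (i - 1) x y) - as i * E i x y)"
        using \<open>s \<noteq> 0\<close> by (simp add: B_def field_simps)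
      also have "\<dots> = s * (E d x y * E j x y)" unfolding *[symmetric] by simp
      finally show "(of_nat n / s) * (E 1 x y * (E d x y * E i x y)) +
        1 * ((- as i / s) * (E d x y * E i x y) + (- bs (i - 1) / s) * B x y) = E d x y * E j x y"
        using \<open>s \<noteq> 0\<close> by (simp only: mult_cancel_left) simp
    qed
  qed
qed

text \<open>The entrywise power is a combination of \<open>E 0, \<dots>, E k\<close>; orthogonality
  of the idempotents squares the coefficients and brings in no new index.\<close>

lemma gram_E_1_Schur_power:
  assumes "k \<le> d" shows "(\<lambda>y y'. \<Sum>x\<in>X. E 1 x y ^ k * E 1 x y' ^ k) \<in> span_E {..k}"
proof -
  obtain g where g: "\<And>x y. x \<in> X \<Longrightarrow> y \<in> X \<Longrightarrow> E 1 x y ^ k = (\<Sum>j\<le>k. g j * E j x y)"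
    using E_1_Schur_power[OF assms] by (auto simp: span_E_def)
  have "(\<Sum>x\<in>X. E 1 x y ^ k * E 1 x y' ^ k) = (\<Sum>i\<le>k. (g i)\<^sup>2 * E i y y')"
    if "y \<in> X" "y' \<in> X" for y y'
  proof -
    have "(\<Sum>x\<in>X. E 1 x y ^ k * E 1 x y' ^ k) =
        (\<Sum>x\<in>X. \<Sum>i\<le>k. \<Sum>j\<le>k. g i * g j * (E i y x * E j x y'))"
    proof (intro sum.cong refl)
      fix x assume "x \<in> X"
      have "E 1 x y ^ k * E 1 x y' ^ k = (\<Sum>i\<le>k. \<Sum>j\<le>k. (g i * E i x y) * (g j * E j x y'))"
        using \<open>x \<in> X\<close> that by (simp only: g sum_product)
      also have "\<dots> = (\<Sum>i\<le>k. \<Sum>j\<le>k. g i * g j * (E i y x * E j x y'))"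
        using assms E_sym[of _ x y] by (intro sum.cong refl) auto
      finally show "E 1 x y ^ k * E 1 x y' ^ k = (\<Sum>i\<le>k. \<Sum>j\<le>k. g i * g j * (E i y x * E j x y'))" .
    qed
    also have "\<dots> = (\<Sum>i\<le>k. \<Sum>j\<le>k. g i * g j * (\<Sum>x\<in>X. E i y x * E j x y'))"
      by (subst sum.swap, intro sum.cong refl, subst sum.swap) (simp add: sum_distrib_left)
    also have "\<dots> = (\<Sum>i\<le>k. \<Sum>j\<le>k. if i = j then g i * g j * E i y y' else 0)"
      using assms by (intro sum.cong refl) (auto simp: E_mult)
    also have "\<dots> = (\<Sum>i\<le>k. (g i)\<^sup>2 * E i y y')"
      by (simp add: power2_eq_square)
    finally show ?thesis .
  qed
  then show ?thesis unfolding span_E_def by auto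
qed

section \<open>Quadratic forms and moments at a set of vertices\<close>

lemma quad_at_eq:
  assumes "Y \<subseteq> X" shows "quad_at G Y M = (\<Sum>x\<in>Y. \<Sum>y\<in>Y. M x y)"
proof -
  have "(\<Sum>y\<in>X. indicator Y x * M x y * indicator Y y) = (\<Sum>y\<in>Y. M x y)" if "x \<in> Y" for x
    using assms that pair_finite_verts by (intro sum.mono_neutral_cong_right) auto
  then show ?thesis
    unfolding quad_at_def using assms pair_finite_verts
    by (intro sum.mono_neutral_cong_right) auto
qed

text \<open>
  The sum of the squares of these (real) numbers over all \<open>x\<close> and \<open>z\<close> is the quadratic form at \<open>Y\<close>
  of the entrywise product of \<open>E d\<close> with a matrix in the span of \<open>E 0, \<dots>, E k\<close>, which lies in the
  span of \<open>E (d - k), \<dots>, E d\<close>.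
\<close>

lemma moments_vanish:
  assumes Y: "Y \<subseteq> X" and quad: "\<And>m. v < m \<Longrightarrow> m \<le> d \<Longrightarrow> quad_at G Y (E m) = 0"
    and k: "k + v < d" and x: "x \<in> X" and z: "z \<in> X"
  shows "(\<Sum>y\<in>Y. E d z y * E 1 x y ^ k) = 0"
proof -
  define s where "s z x = (\<Sum>y\<in>Y. E d z y * E 1 x y ^ k)" for z x
  define P where "P y y' = (\<Sum>x\<in>X. E 1 x y ^ k * E 1 x y' ^ k)" for y y'
  have "d \<ge> 1" using k by simp
  have s_real: "s z x = of_real (Re (s z x))" for z x
  proof -
    have "cnj (s z x) = s z x" unfolding s_def using E_real \<open>d \<ge> 1\<close> by simp
    then show ?thesis by (metis Reals_cnj_iff of_real_Re)
  qed
  have "(\<lambda>y y'. E d y y' * P y y') \<in> span_E {d - k..d}"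
  proof -
    obtain g where g: "\<forall>x\<in>X. \<forall>y\<in>X. P x y = (\<Sum>j\<le>k. g j * E j x y)"
      using gram_E_1_Schur_power[of k] k unfolding span_E_def P_def by auto
    have "(\<lambda>x y. \<Sum>j\<le>k. g j * (E d x y * E j x y)) \<in> span_E {d - k..d}"
      using k by (intro span_E_sum span_E_mono[OF E_d_Schur_E]) auto
    then show ?thesis by (rule span_E_cong) (simp add: g sum_distrib_left mult.left_commute)
  qed
  then obtain h where h: "\<And>y y'. y \<in> X \<Longrightarrow> y' \<in> X \<Longrightarrow> E d y y' * P y y' = (\<Sum>m=d-k..d. h m * E m y y')"
    unfolding span_E_def by auto
  have "(\<Sum>z\<in>X. \<Sum>x\<in>X. s z x * s z x) =
      (\<Sum>z\<in>X. \<Sum>x\<in>X. \<Sum>y\<in>Y. \<Sum>y'\<in>Y. (E d y z * E d z y') * (E 1 x y ^ k * E 1 x y' ^ k))"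
    unfolding s_def using E_sym[of d]
    by (intro sum.cong refl) (auto simp: sum_product intro!: sum.cong)
  also have "\<dots> = (\<Sum>y\<in>Y. \<Sum>y'\<in>Y. \<Sum>z\<in>X. \<Sum>x\<in>X. (E d y z * E d z y') * (E 1 x y ^ k * E 1 x y' ^ k))"
  proof -
    have swap3: "(\<Sum>x\<in>X. \<Sum>y\<in>Y. \<Sum>y'\<in>Y. f x y y') = (\<Sum>y\<in>Y. \<Sum>y'\<in>Y. \<Sum>x\<in>X. f x y y')"
      for f :: "'a \<Rightarrow> 'a \<Rightarrow> 'a \<Rightarrow> complex"
      by (rule trans[OF sum.swap]) (intro sum.cong refl sum.swap)
    show ?thesis by (simp only: swap3)
  qed
  also have "\<dots> = (\<Sum>y\<in>Y. \<Sum>y'\<in>Y. E d y y' * P y y')"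
    unfolding P_def sum_product[symmetric] by (simp add: E_mult)
  also have "\<dots> = (\<Sum>y\<in>Y. \<Sum>y'\<in>Y. \<Sum>m=d-k..d. h m * E m y y')"
    using Y h by (intro sum.cong refl) auto
  also have "\<dots> = (\<Sum>m=d-k..d. h m * quad_at G Y (E m))"
    unfolding quad_at_eq[OF Y] sum_distrib_left
    by (subst (2) sum.swap, subst sum.swap) (rule refl)
  \<comment> \<open>By \<open>k + v < d\<close>, every index from \<open>d - k\<close> on exceeds
    \<open>v\<close>.\<close>
  also have "\<dots> = 0"
    using k by (intro sum.neutral) (auto simp: quad)
  finally have "(\<Sum>z\<in>X. \<Sum>x\<in>X. s z x * s z x) = 0" .
  moreover have "s z x * s z x = of_real ((Re (s z x))\<^sup>2)" for z x
    using s_real[of z x] by (metis of_real_mult power2_eq_square)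
  ultimately have "complex_of_real (\<Sum>z\<in>X. \<Sum>x\<in>X. (Re (s z x))\<^sup>2) = 0" by simp
  then have "(\<Sum>z\<in>X. \<Sum>x\<in>X. (Re (s z x))\<^sup>2) = 0" by (simp only: of_real_eq_0_iff)
  then have "(\<Sum>x\<in>X. (Re (s z x))\<^sup>2) = 0"
    using z pair_finite_verts by (subst (asm) sum_nonneg_eq_0_iff) (auto intro: sum_nonneg)
  then have "(Re (s z x))\<^sup>2 = 0"
    using x pair_finite_verts by (subst (asm) sum_nonneg_eq_0_iff) auto
  then have "s z x = 0" using s_real[of z x] by simp
  then show ?thesis unfolding s_def .
qed

text \<open>The product of \<open>E 0\<close> and \<open>E m\<close> is zero, so the columns of
  \<open>E m\<close> sum to zero. This lets \<open>X\<close> be treated like a descendent of width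
  \<open>d\<close>, next to \<open>Y\<close>.\<close>

lemma quad_at_verts: 
  assumes "0 < m" "m \<le> d" shows "quad_at G X (E m) = 0"
proof -
  have "(\<Sum>x\<in>X. E m x y) = 0" if "y \<in> X" for y
  proof -
    have "(\<Sum>x\<in>X. E 0 y x * E m x y) = 0" using assms by (simp add: E_mult)
    then have "(\<Sum>x\<in>X. E m x y) / of_nat n = 0"
      using that by (simp add: E_0 sum_divide_distrib)
    then show ?thesis using verts_nonempty by simp
  qed
  then show ?thesis by (subst quad_at_eq, simp, subst sum.swap) simp
qed

text \<open>The two products are left undivided here; for the dual eigenvalues of classical
  parameters their ratio is \<open>qnum q w\<close>.\<close>

lemma E_neighbour_sum:
  assumes theta: "dual_eigenvalues G E \<theta>"
    and Y: "Y \<subseteq> X" and w: "1 \<le> w" "w \<le> d"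
    and quad: "\<And>m. d - w < m \<Longrightarrow> m \<le> d \<Longrightarrow> quad_at G Y (E m) = 0"
    and close: "\<And>x y. x \<in> Y \<Longrightarrow> y \<in> Y \<Longrightarrow> \<partial> x y \<le> w"
    and x: "x \<in> Y" and z: "z \<in> X"
  shows "(\<Prod>j=2..w. \<theta> 1 - \<theta> j) * (\<Sum>y\<in>{y\<in>Y. (x, y) \<in> parcs G}. E d z y) =
    - (\<Prod>j=2..w. \<theta> 0 - \<theta> j) * E d z x"
proof -
  define t where "t y = of_nat n * E 1 x y" for y
  have finY: "finite Y" using Y pair_finite_verts by (rule finite_subset)
  have t: "t y = \<theta> (\<partial> x y)" if "y \<in> Y" for y
  proof -
    have "t y = (\<Sum>i\<le>d. \<theta> i * dist_mat G i x y)"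
      using theta by (simp add: t_def dual_eigenvalues_def)
    also have "\<dots> = (\<Sum>i\<le>d. if i = \<partial> x y then \<theta> i else 0)"
      using that x Y by (intro sum.cong) (auto simp: dist_mat_def)
    also have "\<dots> = \<theta> (\<partial> x y)" using dist_le_diam[of x y] that x Y by auto
    finally show ?thesis .
  qed
  have moments: "(\<Sum>y\<in>Y. E d z y * t y ^ k) = 0" if "k < w" for k
  proof -
    have "(\<Sum>y\<in>Y. E d z y * t y ^ k) = of_nat n ^ k * (\<Sum>y\<in>Y. E d z y * E 1 x y ^ k)"
      by (simp add: t_def power_mult_distrib sum_distrib_left mult_ac)
    also have "\<dots> = 0"
    proof -
      have "(\<Sum>y\<in>Y. E d z y * E 1 x y ^ k) = 0"
        \<comment> \<open>For \<open>v = d - w\<close> the condition \<open>k + v < d\<close> says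
          exactly \<open>k < w\<close>.\<close>
        by (rule moments_vanish[OF Y, where v = "d - w"]) (use quad that w x z Y in auto)
      then show ?thesis by simp
    qed
    finally show ?thesis .
  qed
  \<comment> \<open>Of the distances \<open>0, \<dots>, w\<close> occurring from \<open>x\<close> in \<open>Y\<close>, this polynomial of degree \<open>w - 1\<close> in the
    dual eigenvalue isolates \<open>0\<close> and \<open>1\<close>.\<close>
  let ?p = "\<lambda>i. \<Prod>j=2..w. \<theta> i - \<theta> j"
  have p0: "?p i = 0" if "2 \<le> i" "i \<le> w" for i using that by (auto simp: prod_zero_iff)
  have "0 = (\<Sum>y\<in>Y. E d z y * t y ^ 0 * (\<Prod>j=2..w. t y - \<theta> j))"
    by (rule sum_mult_prod_eq_0[OF _ moments, symmetric]) (use w in auto)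
  also have "\<dots> = (\<Sum>y\<in>Y. (if y = x then E d z x * ?p 0 else 0) + (if (x, y) \<in> parcs G then E d z y * ?p 1 else 0))"
  proof (intro sum.cong refl)
    fix y assume y: "y \<in> Y"
    then have yX: "y \<in> X" "x \<in> X" using x Y by auto
    consider "\<partial> x y = 0" | "\<partial> x y = 1" | "2 \<le> \<partial> x y" by linarith
    then show "E d z y * t y ^ 0 * (\<Prod>j=2..w. t y - \<theta> j) =
        (if y = x then E d z x * ?p 0 else 0) + (if (x, y) \<in> parcs G then E d z y * ?p 1 else 0)"
    proof cases
      case 1
      then show ?thesis using dist_eq_0_iff[of x y] yX y no_loops' by (auto simp: t)
    next
      case 2
      then show ?thesis using dist_eq_1_iff[of x y] dist_eq_0_iff[of x y] yX y by (auto simp: t)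
    next
      case 3
      then show ?thesis using dist_eq_1_iff[of x y] dist_eq_0_iff[of x y] yX y p0[of "\<partial> x y"] close[OF x y] by (auto simp: t)
    qed
  qed
  also have "\<dots> = E d z x * ?p 0 + (\<Sum>y\<in>{y\<in>Y. (x, y) \<in> parcs G}. E d z y) * ?p 1"
    using x finY by (simp add: sum.distrib sum.inter_filter[symmetric] sum_distrib_right)
  finally show ?thesis by (simp add: algebra_simps add_eq_0_iff2)
qed

end

section \<open>Sums of powers of \<open>q\<close> and differences of dual eigenvalues\<close>

lemma qnum_0 [simp]: "qnum q 0 = 0"
  and qnum_Suc: "qnum q (Suc i) = qnum q i + q ^ i"
  by (simp_all add: qnum_def)

lemma qnum_add: "qnum q (i + j) = qnum q i + q ^ i * qnum q j"
  by (induction j) (simp_all add: qnum_Suc algebra_simps power_add)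

lemma qnum_diff: "j \<le> d \<Longrightarrow> qnum q d - qnum q (d - j) = q ^ (d - j) * qnum q j"
  using qnum_add[of q "d - j" j] by simp

text \<open>The factors are \<open>\<xi> * q ^ (d - j) * qnum q j\<close> on the left and
  \<open>\<xi> * q ^ (d - j) * qnum q (j - 1)\<close> on the right, so the quotients telescope.
  Stating the result as a product avoids division.\<close>

lemma dual_eigenvalue_products:
  fixes \<theta> :: "nat \<Rightarrow> complex"
  assumes \<theta>: "\<And>i. i \<le> d \<Longrightarrow> \<theta> i = \<xi> * of_real (qnum q (d - i)) + \<zeta>"
    and "1 \<le> w" "w \<le> d"
  shows "(\<Prod>j=2..w. \<theta> 0 - \<theta> j) = of_real (qnum q w) * (\<Prod>j=2..w. \<theta> 1 - \<theta> j)"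
  using assms(2,3)
proof (induction w rule: dec_induct)
  case base
  show ?case by (simp add: qnum_Suc)
next
  case (step w)
  have "\<theta> 0 - \<theta> (Suc w) = \<xi> * of_real (qnum q d - qnum q (d - Suc w))"
    using step.prems by (simp add: \<theta> algebra_simps)
  also have "\<dots> = \<xi> * of_real (q ^ (d - Suc w) * qnum q (Suc w))"
    using qnum_diff[of "Suc w" d q] step.prems by simp
  finally have 0: "\<theta> 0 - \<theta> (Suc w) = \<xi> * of_real (q ^ (d - Suc w)) * of_real (qnum q (Suc w))"
    by simp
  have "\<theta> 1 - \<theta> (Suc w) = \<xi> * of_real (qnum q (d - 1) - qnum q (d - 1 - w))"
    using step.prems by (simp add: \<theta> algebra_simps)
  also have "\<dots> = \<xi> * of_real (q ^ (d - 1 - w) * qnum q w)"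
    using qnum_diff[of w "d - 1" q] step.prems by simp
  finally have 1: "\<theta> 1 - \<theta> (Suc w) = \<xi> * of_real (q ^ (d - Suc w)) * of_real (qnum q w)"
    by simp
  have "{2..Suc w} = insert (Suc w) {2..w}" using step.hyps by auto
  then show ?case using step 1 by (simp add: 0 del: of_real_power of_real_mult)
qed

lemma dual_eigenvalue_product_nonzero:
  fixes \<theta> :: "nat \<Rightarrow> complex"
  assumes \<theta>: "\<And>i. i \<le> d \<Longrightarrow> \<theta> i = \<xi> * of_real (qnum q (d - i)) + \<zeta>"
    and "w \<le> d" "\<xi> \<noteq> 0" "q \<noteq> 0" and qnum: "\<And>j. 1 \<le> j \<Longrightarrow> j \<le> d \<Longrightarrow> qnum q j \<noteq> 0"
  shows "(\<Prod>j=2..w. \<theta> 1 - \<theta> j) \<noteq> 0"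
proof -
  have "\<theta> 1 - \<theta> j \<noteq> 0" if "2 \<le> j" "j \<le> w" for j
  proof -
    have "\<theta> 1 - \<theta> j = \<xi> * of_real (qnum q (d - 1) - qnum q (d - 1 - (j - 1)))"
      using that assms(2) by (simp add: \<theta> algebra_simps)
    also have "\<dots> = \<xi> * of_real (q ^ (d - 1 - (j - 1)) * qnum q (j - 1))"
      using qnum_diff[of "j - 1" "d - 1" q] that assms(2) by simp
    finally show ?thesis using that assms qnum[of "j - 1"] by simp
  qed
  then show ?thesis by (simp add: prod_zero_iff)
qed

section \<open>Width, dual width and the local graph at a vertex\<close>

context q_polynomial_graph
begin

text \<open>The quadratic form of a distance matrix counts ordered pairs of \<open>Y\<close> at that
  distance, so a distance that occurs in \<open>Y\<close> gives a nonzero value.\<close>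

lemma dist_le_width:
  assumes "Y \<subseteq> X" "x \<in> Y" "y \<in> Y" shows "\<partial> x y \<le> width G Y"
proof -
  have "quad_at G Y (dist_mat G (\<partial> x y)) = of_nat (card {(u, v) \<in> Y \<times> Y. \<partial> u v = \<partial> x y})"
  proof -
    have "quad_at G Y (dist_mat G (\<partial> x y)) = (\<Sum>(u, v)\<in>Y \<times> Y. if \<partial> u v = \<partial> x y then 1 else 0)"
      unfolding quad_at_eq[OF assms(1)] sum.cartesian_product
      using assms(1) by (intro sum.cong) (auto simp: dist_mat_def)
    also have "\<dots> = of_nat (card {p \<in> Y \<times> Y. \<partial> (fst p) (snd p) = \<partial> x y})"
      using finite_subset[OF assms(1) pair_finite_verts]
      by (simp add: case_prod_unfold sum.If_cases Int_def)
    finally show ?thesis by (simp add: case_prod_unfold mem_Times_iff conj_assoc)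
  qed
  moreover have "card {(u, v) \<in> Y \<times> Y. \<partial> u v = \<partial> x y} \<noteq> 0"
    using assms finite_subset[OF assms(1) pair_finite_verts]
    by (subst card_0_eq) (auto intro: finite_subset[of _ "Y \<times> Y"])
  ultimately have "quad_at G Y (dist_mat G (\<partial> x y)) \<noteq> 0" by simp
  then show ?thesis
    unfolding width_def using assms dist_le_diam by (intro Max_ge) auto
qed

lemma quad_at_above_dual_width:
  assumes "dual_width G E Y < m" "m \<le> d" shows "quad_at G Y (E m) = 0"
proof (rule ccontr)
  assume "quad_at G Y (E m) \<noteq> 0"
  then have "m \<le> dual_width G E Y"
    unfolding dual_width_def using assms by (intro Max_ge) auto
  with assms show False by simp
qed

text \<open>Two neighbours of \<open>x\<close> are at distance at most 2. The constant
  \<open>e 2\<close> is corrected by \<open>e 1 - e 2\<close> on the closed neighbourhood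
  \<open>K\<close> of \<open>z\<close> in the local graph, and further by \<open>e 0 - e 1\<close>
  at \<open>z\<close> itself.\<close>

lemma E_d_sum_local_graph:
  assumes e: "\<And>u v. u \<in> X \<Longrightarrow> v \<in> X \<Longrightarrow> E d u v = e (\<partial> u v)"
    and x: "x \<in> X" and S: "S \<subseteq> {y. (x, y) \<in> parcs G}" and z: "(x, z) \<in> parcs G"
  defines "K \<equiv> {y. (x, y) \<in> parcs G \<and> (y = z \<or> (z, y) \<in> parcs G)}"
  shows "(\<Sum>y\<in>S. E d z y) =
    (if z \<in> S then e 0 - e 1 else 0) + of_nat (card (S \<inter> K)) * (e 1 - e 2) + of_nat (card S) * e 2"
proof -
  have finS: "finite S" using finite_subset[OF S] finite_nbrs[of x "\<lambda>_. True"] by simp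
  have zX: "z \<in> X" using z in_arcsD2 by blast
  have "E d z y = (if y = z then e 0 - e 1 else 0) + (if y \<in> K then e 1 - e 2 else 0) + e 2"
    if "y \<in> S" for y
  proof -
    have xy: "(x, y) \<in> parcs G" and yX: "y \<in> X" using that S in_arcsD2 by auto
    have "\<partial> z y \<le> 2"
      using dist_arc_le[OF zX xy] dist_arc_le[OF zX arc_sym[OF z]] zX by simp
    then have "\<partial> z y = 0 \<or> \<partial> z y = 1 \<or> \<partial> z y = 2" by linarith
    then show ?thesis
      using dist_eq_0_iff[OF zX yX] dist_eq_1_iff[OF zX yX] xy
      by (auto simp: e zX yX K_def)
  qed
  then have "(\<Sum>y\<in>S. E d z y) =
      (\<Sum>y\<in>S. (if y = z then e 0 - e 1 else 0) + (if y \<in> K then e 1 - e 2 else 0) + e 2)"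
    by (intro sum.cong) auto
  also have "\<dots> = (if z \<in> S then e 0 - e 1 else 0) + of_nat (card (S \<inter> K)) * (e 1 - e 2) + of_nat (card S) * e 2"
    using finS by (simp add: sum.distrib sum.If_cases)
  finally show ?thesis .
qed

text \<open>The remaining neighbours of \<open>x\<close> are those at distance 2 from
  \<open>z\<close>; since \<open>x\<close> is at distance 1 from \<open>z\<close>, there are
  \<open>b 1\<close> of them.\<close>

lemma card_local_clique:
  assumes "(x, z) \<in> parcs G"
  shows "int (card {y. (x, y) \<in> parcs G \<and> (y = z \<or> (z, y) \<in> parcs G)}) = b 0 - b 1"
proof -
  let ?K = "{y. (x, y) \<in> parcs G \<and> (y = z \<or> (z, y) \<in> parcs G)}"
  have x: "x \<in> X" and z: "z \<in> X" using assms in_arcsD1 in_arcsD2 by auto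
  have zx: "\<partial> z x = 1" using dist_eq_1_iff[OF z x] arc_sym[OF assms] by simp
  have "y \<in> ?K \<longleftrightarrow> \<partial> z y \<noteq> Suc 1" if y: "(x, y) \<in> parcs G" for y
  proof -
    have yX: "y \<in> X" using y in_arcsD2 by blast
    have "\<partial> z y \<le> 2" using dist_arc_le[OF z y] zx by simp
    then have "\<partial> z y = 0 \<or> \<partial> z y = 1 \<or> \<partial> z y = 2" by linarith
    then show ?thesis
      using dist_eq_0_iff[OF z yX] dist_eq_1_iff[OF z yX] y by auto
  qed
  then have "{y. (x, y) \<in> parcs G} = ?K \<union> {y. (x, y) \<in> parcs G \<and> \<partial> z y = Suc 1}"
    and "?K \<inter> {y. (x, y) \<in> parcs G \<and> \<partial> z y = Suc 1} = {}"
    by blast+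
  then have "card {y. (x, y) \<in> parcs G} = card ?K + card {y. (x, y) \<in> parcs G \<and> \<partial> z y = Suc 1}"
    by (simp add: card_Un_disjoint finite_nbrs)
  then show ?thesis
    using valency[OF x] card_forward[OF z x zx] by linarith
qed

end

text \<open>The structure of dual polar graphs enters through \<open>cliques\<close> alone, which
  says that every local graph is a disjoint union of cliques. The condition
  \<open>\<beta> \<noteq> -1\<close> separates \<open>e 0\<close> from \<open>e 1\<close>, and
  \<open>\<alpha> \<noteq> 0\<close> contradicts the clique size found at the end.\<close>

theorem no_nontrivial_descendent_if_local_graph_cliques:
  assumes std: "standard_ordering G d q \<alpha> \<beta> E"
    and q: "q \<noteq> 0" "\<And>j. 1 \<le> j \<Longrightarrow> j \<le> d \<Longrightarrow> qnum q j \<noteq> 0" "qnum q d \<noteq> 1"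
    and \<alpha>\<beta>: "\<alpha> \<noteq> 0" "\<beta> \<noteq> -1"
    and cliques: "\<And>x y z t. (x, y) \<in> parcs G \<Longrightarrow> (x, z) \<in> parcs G \<Longrightarrow> (x, t) \<in> parcs G \<Longrightarrow>
      (y, z) \<in> parcs G \<Longrightarrow> (z, t) \<in> parcs G \<Longrightarrow> y = t \<or> (y, t) \<in> parcs G"
  shows "\<not> nontrivial_descendent G E Y"
proof
  assume "nontrivial_descendent G E Y"
  then have Y: "Y \<noteq> {}" "Y \<subseteq> pverts G" "width G Y + dual_width G E Y = diam G"
    and nontriv: "width G Y \<noteq> 0" "width G Y \<noteq> diam G"
    by (auto simp: nontrivial_descendent_def trivial_descendent_def descendent_def)
  obtain b c where bc: "intersection_numbers G b c"
    and b: "\<And>i. i \<le> d \<Longrightarrow> real_of_int (b i) = (qnum q d - qnum q i) * (\<beta> - \<alpha> * qnum q i)"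
    and drg: "distance_regular G" and diam: "diam G = d" and Q: "Q_polynomial G E"
    using std unfolding standard_ordering_def classical_parameters_def by blast
  obtain \<theta> \<xi> \<zeta> where \<theta>: "dual_eigenvalues G E \<theta>" "\<xi> \<noteq> 0"
    "\<And>i. i \<le> d \<Longrightarrow> \<theta> i = \<xi> * of_real (qnum q (d - i)) + \<zeta>"
    using std unfolding standard_ordering_def by blast
  interpret pair_graph G using drg by (simp add: distance_regular_def)
  interpret q_polynomial_graph G b c E
    using drg bc Q by unfold_locales (auto simp: distance_regular_def)
  define w where "w = width G Y"
  have w: "1 \<le> w" "w < d" using Y nontriv by (auto simp: w_def diam)
  obtain x where x: "x \<in> Y" using Y by blast
  then have xX: "x \<in> X" using Y by blast
  define \<Gamma> where "\<Gamma> = {y. (x, y) \<in> parcs G}"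
  define N where "N = {y \<in> Y. (x, y) \<in> parcs G}"
  \<comment> \<open>Stated for a general set \<open>Z\<close> and width \<open>v\<close>, to serve
    both \<open>Y\<close> with \<open>w\<close> and \<open>X\<close> with \<open>d\<close>.\<close>
  have E_sum: "(\<Sum>y\<in>{y \<in> Z. (x, y) \<in> parcs G}. E d z y) = - of_real (qnum q v) * E d z x"
    if Z: "Z \<subseteq> X" "x \<in> Z" and v: "1 \<le> v" "v \<le> d" and z: "z \<in> X"
      and quad: "\<And>m. d - v < m \<Longrightarrow> m \<le> d \<Longrightarrow> quad_at G Z (E m) = 0"
      and close: "\<And>x y. x \<in> Z \<Longrightarrow> y \<in> Z \<Longrightarrow> \<partial> x y \<le> v" for Z v z
  proof -
    have "(\<Prod>j=2..v. \<theta> 1 - \<theta> j) * (\<Sum>y\<in>{y \<in> Z. (x, y) \<in> parcs G}. E d z y) =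
        - (\<Prod>j=2..v. \<theta> 0 - \<theta> j) * E d z x"
      using E_neighbour_sum[OF \<theta>(1) Z(1) v(1) _ _ close Z(2) z] v quad by (simp add: diam)
    also have "\<dots> = (\<Prod>j=2..v. \<theta> 1 - \<theta> j) * (- of_real (qnum q v) * E d z x)"
      using dual_eigenvalue_products[OF \<theta>(3) v] by simp
    finally have eq: "(\<Prod>j=2..v. \<theta> 1 - \<theta> j) * (\<Sum>y\<in>{y \<in> Z. (x, y) \<in> parcs G}. E d z y) =
        (\<Prod>j=2..v. \<theta> 1 - \<theta> j) * (- of_real (qnum q v) * E d z x)" .
    have nz: "(\<Prod>j=2..v. \<theta> 1 - \<theta> j) \<noteq> 0"
      using v(2) by (intro dual_eigenvalue_product_nonzero[OF \<theta>(3) _ \<theta>(2) q(1,2)])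
    show ?thesis by (rule mult_left_cancel[OF nz, THEN iffD1, OF eq])
  qed
  have sum_N: "(\<Sum>y\<in>N. E d z y) = - of_real (qnum q w) * E d z x" if "z \<in> X" for z
    unfolding N_def
  proof (rule E_sum)
    show "quad_at G Y (E m) = 0" if "d - w < m" "m \<le> d" for m
      using that Y w by (intro quad_at_above_dual_width) (auto simp: w_def diam)
    show "\<partial> x y \<le> w" if "x \<in> Y" "y \<in> Y" for x y
      using dist_le_width[OF Y(2)] that by (simp add: w_def)
  qed (use that Y x w in auto)
  have sum_\<Gamma>: "(\<Sum>y\<in>\<Gamma>. E d z y) = - of_real (qnum q d) * E d z x" if "z \<in> X" for z
  proof -
    have "\<Gamma> = {y \<in> X. (x, y) \<in> parcs G}" by (auto simp: \<Gamma>_def dest: in_arcsD2)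
    then show ?thesis
      using E_sum[of X d z] that xX w quad_at_verts dist_le_diam by (simp add: diam)
  qed
  obtain e where "E d = (\<lambda>x y. if x \<in> X \<and> y \<in> X then e (\<partial> x y) else 0)"
    using E_in_bose_mesner[of d] by (auto simp: diam elim: bose_mesnerE)
  then have e: "E d u v = e (\<partial> u v)" if "u \<in> X" "v \<in> X" for u v using that by simp
  have e0: "e 0 \<noteq> 0" using E_diagonal_nonzero[of d x] e[of x x] xX by (simp add: diam)
  have row_x: "(\<Sum>y\<in>S. E d x y) = of_nat (card S) * e 1" if "S \<subseteq> \<Gamma>" for S
  proof -
    have "E d x y = e 1" if "y \<in> S" for y
      using e[of x y] dist_eq_1_iff[of x y] in_arcsD2[of x y] that \<open>S \<subseteq> \<Gamma>\<close> xX by (auto simp: \<Gamma>_def)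
    then show ?thesis by simp
  qed
  have N\<Gamma>: "N \<subseteq> \<Gamma>" by (auto simp: N_def \<Gamma>_def)
  \<comment> \<open>The row at \<open>x\<close> itself, where every neighbour contributes
    \<open>e 1\<close>.\<close>
  have eq1: "of_nat (card N) * e 1 = - of_real (qnum q w) * e 0"
    using row_x[OF N\<Gamma>] sum_N[OF xX] e[OF xX xX] xX by simp
  have eq2: "of_nat (card \<Gamma>) * e 1 = - of_real (qnum q d) * e 0"
    using row_x[of \<Gamma>] sum_\<Gamma>[OF xX] e[OF xX xX] xX by simp
  have card_\<Gamma>: "real (card \<Gamma>) = qnum q d * \<beta>"
    using valency[OF xX] b[of 0] unfolding \<Gamma>_def by (metis diff_zero le0 mult_zero_right of_int_of_nat_eq qnum_0)
  have nz: "complex_of_real (qnum q w) \<noteq> 0" "complex_of_real (qnum q d) \<noteq> 0" using q(2) w by auto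
  \<comment> \<open>An empty \<open>N\<close> would make the left side of \<open>eq1\<close> zero,
    while the right side is not.\<close>
  have "N \<noteq> {}" using eq1 nz(1) e0 by auto
  then obtain z where zN: "z \<in> N" by blast
  define K where "K = {y. (x, y) \<in> parcs G \<and> (y = z \<or> (z, y) \<in> parcs G)}"
  have xz: "(x, z) \<in> parcs G" and zX: "z \<in> X" using zN N\<Gamma> in_arcsD2 by (auto simp: \<Gamma>_def)
  have e_arc: "E d u x = e 1" if "(x, u) \<in> parcs G" for u
    using e[of u x] dist_eq_1_iff[of u x] arc_sym[OF that] in_arcsD2[OF that] xX by simp
  have zK: "z \<in> K" using xz by (simp add: K_def)
  \<comment> \<open>With \<open>e 0 = e 1\<close>, \<open>eq2\<close> would say that the valency
    \<open>qnum q d * \<beta>\<close> equals \<open>- qnum q d\<close>.\<close>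
  have e01: "e 0 \<noteq> e 1"
  proof
    assume "e 0 = e 1"
    then have "complex_of_real (real (card \<Gamma>) + qnum q d) * e 0 = 0"
      using eq2 by (simp add: algebra_simps)
    then have "qnum q d * (\<beta> + 1) = 0"
      using e0 card_\<Gamma> by (simp add: algebra_simps flip: of_real_add of_real_mult)
    then show False using nz(2) \<alpha>\<beta>(2) by simp
  qed
  \<comment> \<open>Every \<open>u\<close> in the clique \<open>K\<close> has the same closed
    neighbourhood \<open>K\<close> in the local graph, so the identities for different
    \<open>u\<close> differ only in the first term.\<close>
  have N_eq: "(if u \<in> N then e 0 - e 1 else 0) + of_nat (card (N \<inter> K)) * (e 1 - e 2) + of_nat (card N) * e 2
      = - of_real (qnum q w) * e 1" if "u \<in> K" for u
  proof -
    have xu: "(x, u) \<in> parcs G" using that by (simp add: K_def)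
    have "{y. (x, y) \<in> parcs G \<and> (y = u \<or> (u, y) \<in> parcs G)} = K"
    proof (cases "u = z")
      case False
      with that have zu: "(z, u) \<in> parcs G" by (simp add: K_def)
      show ?thesis
        unfolding K_def using cliques[OF xu xz _ arc_sym[OF zu]] cliques[OF xz xu _ zu] xu xz zu arc_sym
        by blast
    qed (simp add: K_def)
    then show ?thesis
      using E_d_sum_local_graph[of e x N u] e xX N\<Gamma> xu sum_N[of u] in_arcsD2[OF xu] e_arc[OF xu]
      by (simp add: \<Gamma>_def diam)
  qed
  have "K \<subseteq> N"
  proof
    fix u assume "u \<in> K"
    show "u \<in> N"
    proof (rule ccontr)
      assume "u \<notin> N"
      then have u: "of_nat (card (N \<inter> K)) * (e 1 - e 2) + of_nat (card N) * e 2 = - of_real (qnum q w) * e 1"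
        using N_eq[OF \<open>u \<in> K\<close>] by simp
      have "e 0 - e 1 + (of_nat (card (N \<inter> K)) * (e 1 - e 2) + of_nat (card N) * e 2) = - of_real (qnum q w) * e 1"
        using N_eq[OF zK] zN by (simp add: add.assoc)
      then show False unfolding u using e01 by simp
    qed
  qed
  then have eq3: "e 0 - e 1 + of_nat (card K) * (e 1 - e 2) + of_nat (card N) * e 2 = - of_real (qnum q w) * e 1"
    using N_eq[OF zK] zN by (simp add: Int_absorb1)
  have eq4: "e 0 - e 1 + of_nat (card K) * (e 1 - e 2) + of_nat (card \<Gamma>) * e 2 = - of_real (qnum q d) * e 1"
  proof -
    have "\<Gamma> \<inter> K = K" "z \<in> \<Gamma>" using xz by (auto simp: K_def \<Gamma>_def)
    then show ?thesis
      using E_d_sum_local_graph[of e x \<Gamma> z] e xX xz sum_\<Gamma>[OF zX] e_arc[OF xz]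
      by (simp add: \<Gamma>_def diam K_def)
  qed
  \<comment> \<open>This is \<open>b 0 - b 1\<close>, evaluated with
    \<open>qnum q 1 = 1\<close>.\<close>
  have card_K: "real (card K) = \<beta> + \<alpha> * (qnum q d - 1)"
  proof -
    have "real (card K) = real_of_int (b 0) - real_of_int (b 1)"
      using card_local_clique[OF xz] unfolding K_def by linarith
    then show ?thesis using b[of 0] b[of 1] w by (simp add: qnum_Suc algebra_simps)
  qed
  define B where "B = complex_of_real \<beta>"
  define k where "k = complex_of_real (real (card K))"
  define W where "W = complex_of_real (qnum q w)"
  define D where "D = complex_of_real (qnum q d)"
  define M where "M = complex_of_real (real (card N))"
  have "complex_of_real (real (card \<Gamma>)) = D * B" using card_\<Gamma> by (simp add: D_def B_def)
  note eqs = eq1 eq2 eq3 eq4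
  have 1: "M * e 1 = - W * e 0" and 2: "D * B * e 1 = - D * e 0"
    and 3: "e 0 - e 1 + k * (e 1 - e 2) + M * e 2 = - W * e 1"
    and 4: "e 0 - e 1 + k * (e 1 - e 2) + D * B * e 2 = - D * e 1"
    using eqs \<open>complex_of_real (real (card \<Gamma>)) = D * B\<close> by (simp_all add: M_def W_def D_def k_def)
  have "D \<noteq> 0" "W \<noteq> 0" using nz by (simp_all add: D_def W_def)
  have "D * (B * e 1) = D * (- e 0)" using 2 by (simp add: mult.assoc)
  then have Be1: "B * e 1 = - e 0" using \<open>D \<noteq> 0\<close> by (rule mult_left_cancel[THEN iffD1, rotated])
  have "qnum q d - qnum q w = q ^ w * qnum q (d - w)"
    using qnum_add[of q w "d - w"] w by simp
  then have "qnum q d \<noteq> qnum q w" using q w by auto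
  then have DW: "D - W \<noteq> 0" by (simp add: D_def W_def)
  have e1: "e 1 \<noteq> 0" using 1 \<open>W \<noteq> 0\<close> e0 by auto
  \<comment> \<open>In effect \<open>M = B * W\<close>: the number of neighbours of \<open>x\<close>
    in \<open>Y\<close> is \<open>\<beta> * qnum q w\<close>.\<close>
  have "(M - D * B) * e 1 = (D - W) * e 0" unfolding left_diff_distrib 1 2 by simp
  also have "\<dots> = (D - W) * - (B * e 1)" unfolding Be1 by simp
  also have "\<dots> = (- B * (D - W)) * e 1" by (simp add: algebra_simps)
  finally have "M - D * B = - B * (D - W)" by (simp only: mult_right_cancel[OF e1])
  moreover have "(M - D * B) * e 2 =
      (e 0 - e 1 + k * (e 1 - e 2) + M * e 2) - (e 0 - e 1 + k * (e 1 - e 2) + D * B * e 2)"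
    by (simp add: algebra_simps)
  \<comment> \<open>The terms with \<open>k\<close> cancel in the difference of 3 and 4.\<close>
  ultimately have "- B * (D - W) * e 2 = - W * e 1 - - D * e 1" unfolding 3 4 by simp
  then have "(D - W) * (B * e 2 + e 1) = 0" by algebra
  then have Be2: "B * e 2 + e 1 = 0" using DW by simp
  \<comment> \<open>Since \<open>B * e 2 = - e 1\<close>, the terms of 4 that contain
    \<open>D\<close> cancel.\<close>
  then have 5: "e 0 - e 1 + k * (e 1 - e 2) = 0" using 4 by algebra
  have "(B + 1) * (B - k) * e 0 = 0"
  proof -
    \<comment> \<open>Eliminates \<open>e 1\<close> and \<open>e 2\<close>: multiply 5 by
      \<open>B * B\<close> and substitute \<open>B * e 2 = - e 1\<close>, then
      \<open>B * e 1 = - e 0\<close>.\<close>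
    have "(B + 1) * (B - k) * e 0 = B * B * (e 0 - e 1 + k * (e 1 - e 2)) +
        (B - k * B - k) * (B * e 1 + e 0) + k * B * (B * e 2 + e 1)"
      by algebra
    then show ?thesis unfolding 5 Be1 Be2 by simp
  qed
  moreover have "B + 1 \<noteq> 0" using \<alpha>\<beta>(2) unfolding B_def by (metis add_eq_0_iff2 of_real_1 of_real_eq_iff of_real_minus)
  ultimately have "B = k" using e0 by simp
  \<comment> \<open>The clique size is now \<open>\<beta>\<close>, against the value in
    \<open>card_K\<close>.\<close>
  then have "\<alpha> * (qnum q d - 1) = 0" using card_K by (simp add: B_def k_def)
  then show False using \<alpha>\<beta>(1) q(3) by simp
qed

section \<open>Dual polar graphs\<close>

lemma hermitean_form_linear_left:
  assumes "hermitean_form l h"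
  shows "h (x + x') y = h x y + h x' y" "h (a *s x) y = a * h x y"
proof -
  have "Vector_Spaces.linear (*s) (*) (\<lambda>x. h x y)"
    using assms unfolding hermitean_form_def by blast
  then show "h (x + x') y = h x y + h x' y" "h (a *s x) y = a * h x y"
    unfolding Vector_Spaces.linear_iff by blast+
qed

lemma hermitean_form_orthogonal_sym:
  assumes "hermitean_form l h" "0 < l" "h x y = 0" shows "h y x = 0"
proof -
  have "h y x = h x y ^ l" using assms(1) unfolding hermitean_form_def by blast
  then show ?thesis using assms(2,3) by simp
qed

text \<open>Used to contradict maximality. Members of the span have the form
  \<open>u + a *s v\<close>, and all four terms of the expanded form vanish.\<close>

lemma isotropic_subspace_span_insert:
  fixes h :: "'k::field ^ 'n::finite \<Rightarrow> 'k ^ 'n \<Rightarrow> 'k"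
  assumes h: "hermitean_form l h" "0 < l" and W: "isotropic_subspace h W"
    and v: "h v v = 0" "\<And>x. x \<in> W \<Longrightarrow> h x v = 0"
  shows "isotropic_subspace h (vec.span (insert v W))"
proof -
  have W_sub: "vec.subspace W" and W_iso: "\<And>x y. x \<in> W \<Longrightarrow> y \<in> W \<Longrightarrow> h x y = 0"
    using W by (auto simp: isotropic_subspace_def)
  note sym = hermitean_form_orthogonal_sym[OF h]
  have dec: "\<exists>a. \<exists>u\<in>W. x = u + a *s v" if x: "x \<in> vec.span (insert v W)" for x
  proof -
    obtain a where "x - a *s v \<in> W"
      using x unfolding vec.span_insert vec.span_eq_iff[THEN iffD2, OF W_sub] by blast
    then show ?thesis by (intro exI bexI[of _ "x - a *s v"]) auto
  qed
  \<comment> \<open>The form is given as linear in its first argument only; symmetry of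
    orthogonality carries this over to the second.\<close>
  have right: "h u (u' + a *s v) = 0" if "h u u' = 0" "h u v = 0" for u u' a
  proof (rule sym)
    show "h (u' + a *s v) u = 0"
      using sym[OF that(1)] sym[OF that(2)] by (simp add: hermitean_form_linear_left[OF h(1)])
  qed
  have "h x y = 0" if xy: "x \<in> vec.span (insert v W)" "y \<in> vec.span (insert v W)" for x y
  proof -
    obtain a u where x: "x = u + a *s v" "u \<in> W" using dec xy by blast
    obtain b u' where y: "y = u' + b *s v" "u' \<in> W" using dec xy by blast
    have "h u y = 0" unfolding y(1) by (rule right[OF W_iso[OF x(2) y(2)] v(2)[OF x(2)]])
    moreover have "h v y = 0" unfolding y(1) by (rule right[OF sym[OF v(2)[OF y(2)]] v(1)])
    ultimately show ?thesis unfolding x by (simp add: hermitean_form_linear_left[OF h(1)])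
  qed
  then show ?thesis by (simp add: isotropic_subspace_def)
qed

lemma subspace_subset_if_dim_le_dim_Int:
  fixes S T :: "('k::field ^ 'n::finite) set"
  assumes "vec.subspace S" "vec.subspace T" "vec.dim S \<le> vec.dim (S \<inter> T)"
  shows "S \<subseteq> T"
proof -
  have "S \<inter> T = S"
    using assms by (intro vec.subspace_dim_equal vec.subspace_inter Int_lower1)
  then show ?thesis by blast
qed

lemma dual_polar_arc_iff:
  "(V, W) \<in> parcs (dual_polar_graph d h) \<longleftrightarrow>
    V \<in> dual_polar_vertices d h \<and> W \<in> dual_polar_vertices d h \<and> vec.dim (V \<inter> W) = d - 1"
  by (simp add: dual_polar_graph_def)

text \<open>If the hyperplanes \<open>x \<inter> y\<close> and \<open>x \<inter> z\<close> of
  \<open>x\<close> were distinct, they would generate \<open>x\<close>. A vector of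
  \<open>y \<inter> z\<close> outside \<open>x\<close> is orthogonal to both, hence to
  \<open>x\<close>, and would enlarge the maximal isotropic subspace \<open>x\<close>.\<close>

lemma dual_polar_triangle_Int:
  fixes h :: "'k::field ^ 'n::finite \<Rightarrow> 'k ^ 'n \<Rightarrow> 'k"
  assumes h: "hermitean_form l h" "0 < l" and d: "0 < d"
    and xy: "(x, y) \<in> parcs (dual_polar_graph d h)"
    and xz: "(x, z) \<in> parcs (dual_polar_graph d h)"
    and yz: "(y, z) \<in> parcs (dual_polar_graph d h)"
  shows "x \<inter> y = x \<inter> z"
proof (rule ccontr)
  assume ne: "x \<inter> y \<noteq> x \<inter> z"
  have sub: "vec.subspace x" "vec.subspace y" "vec.subspace z"
    and x: "maximal_isotropic_subspace h x" "vec.dim x = d"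
    and y_iso: "\<And>u v. u \<in> y \<Longrightarrow> v \<in> y \<Longrightarrow> h u v = 0"
    and z_iso: "\<And>u v. u \<in> z \<Longrightarrow> v \<in> z \<Longrightarrow> h u v = 0"
    and dims: "vec.dim (x \<inter> y) = d - 1" "vec.dim (x \<inter> z) = d - 1" "vec.dim (y \<inter> z) = d - 1"
    using xy xz yz
    by (auto simp: dual_polar_arc_iff dual_polar_vertices_def maximal_isotropic_subspace_def isotropic_subspace_def)
  note subs = sub vec.subspace_inter[OF sub(1,2)] vec.subspace_inter[OF sub(1,3)] vec.subspace_inter[OF sub(2,3)]
  \<comment> \<open>Inside \<open>x\<close>, the space \<open>y \<inter> z\<close> would coincide,
    by its dimension, with both hyperplanes.\<close>
  have "\<not> y \<inter> z \<subseteq> x"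
  proof
    assume yz_x: "y \<inter> z \<subseteq> x"
    have "y \<inter> z = x \<inter> y" "y \<inter> z = x \<inter> z"
      by (rule vec.subspace_dim_equal; use yz_x dims subs in auto)+
    with ne show False by simp
  qed
  then obtain v where v: "v \<in> y" "v \<in> z" "v \<notin> x" by blast
  let ?S = "{a + b |a b. a \<in> x \<inter> y \<and> b \<in> x \<inter> z}"
  have "vec.dim ?S + vec.dim ((x \<inter> y) \<inter> (x \<inter> z)) = (d - 1) + (d - 1)"
    using vec.dim_sums_Int[OF subs(4,5)] dims by simp
  moreover have "vec.dim ((x \<inter> y) \<inter> (x \<inter> z)) < d - 1"
  proof (rule ccontr)
    assume "\<not> vec.dim ((x \<inter> y) \<inter> (x \<inter> z)) < d - 1"
    then have ge: "d - 1 \<le> vec.dim ((x \<inter> y) \<inter> (x \<inter> z))" by simp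
    have "x \<inter> y \<subseteq> x \<inter> z"
      by (rule subspace_subset_if_dim_le_dim_Int) (use subs dims ge in simp_all)
    moreover have "x \<inter> z \<subseteq> x \<inter> y"
      by (rule subspace_subset_if_dim_le_dim_Int) (use subs dims ge in \<open>simp_all add: Int_commute\<close>)
    ultimately show False using ne by blast
  qed
  \<comment> \<open>The dimensions add up to \<open>2 * (d - 1)\<close>, and the intersection
    accounts for at most \<open>d - 2\<close>.\<close>
  ultimately have "d \<le> vec.dim ?S" by linarith
  moreover have "?S \<subseteq> x" using sub(1) by (auto intro: vec.subspace_add)
  ultimately have S: "?S = x"
    using subs x by (intro vec.subspace_dim_equal vec.subspace_sums) auto
  have orth: "h u v = 0" if u: "u \<in> x" for u
  proof -
    have "u \<in> ?S" unfolding S by (rule u)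
    then obtain a b where "u = a + b" "a \<in> x \<inter> y" "b \<in> x \<inter> z" by blast
    then show ?thesis
      using y_iso z_iso v by (simp add: hermitean_form_linear_left[OF h(1)])
  qed
  have "isotropic_subspace h (vec.span (insert v x))"
    using x y_iso v orth by (intro isotropic_subspace_span_insert[OF h]) (auto simp: maximal_isotropic_subspace_def)
  moreover have "insert v x \<subseteq> vec.span (insert v x)" by (rule vec.span_superset)
  ultimately show False
    using x(1) v(3) unfolding maximal_isotropic_subspace_def by blast
qed

text \<open>Both triangles contain \<open>x\<close> and \<open>z\<close>, so \<open>y\<close>,
  \<open>z\<close> and \<open>t\<close> meet \<open>x\<close> in one hyperplane. It lies in
  \<open>y \<inter> t\<close>, whose dimension is thus at least \<open>d - 1\<close>, and less than
  \<open>d\<close> if \<open>y\<close> and \<open>t\<close> differ.\<close>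

lemma dual_polar_local_cliques:
  fixes h :: "'k::field ^ 'n::finite \<Rightarrow> 'k ^ 'n \<Rightarrow> 'k"
  assumes h: "hermitean_form l h" "0 < l" and d: "0 < d"
    and xy: "(x, y) \<in> parcs (dual_polar_graph d h)"
    and xz: "(x, z) \<in> parcs (dual_polar_graph d h)"
    and xt: "(x, t) \<in> parcs (dual_polar_graph d h)"
    and yz: "(y, z) \<in> parcs (dual_polar_graph d h)"
    and zt: "(z, t) \<in> parcs (dual_polar_graph d h)"
  shows "y = t \<or> (y, t) \<in> parcs (dual_polar_graph d h)"
proof (cases "y = t")
  case False
  have "x \<inter> y = x \<inter> t"
    using dual_polar_triangle_Int[OF h d xy xz yz] dual_polar_triangle_Int[OF h d xz xt zt] by simp
  then have "x \<inter> y \<subseteq> y \<inter> t" by blast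
  then have "d - 1 \<le> vec.dim (y \<inter> t)"
    using vec.dim_subset[of "x \<inter> y" "y \<inter> t"] xy by (simp add: dual_polar_arc_iff)
  moreover have "vec.dim (y \<inter> t) < d"
  proof (rule ccontr)
    assume "\<not> vec.dim (y \<inter> t) < d"
    then have ge: "d \<le> vec.dim (y \<inter> t)" by simp
    have yt: "vec.subspace y" "vec.subspace t" "vec.dim y = d" "vec.dim t = d"
      using xy xt by (auto simp: dual_polar_arc_iff dual_polar_vertices_def
          maximal_isotropic_subspace_def isotropic_subspace_def)
    have "y \<subseteq> t"
      by (rule subspace_subset_if_dim_le_dim_Int) (use yt ge in simp_all)
    moreover have "t \<subseteq> y"
      by (rule subspace_subset_if_dim_le_dim_Int) (use yt ge in \<open>simp_all add: Int_commute\<close>)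
    ultimately show False using False by simp
  qed
  ultimately have "vec.dim (y \<inter> t) = d - 1" by linarith
  then show ?thesis using xy xt by (simp add: dual_polar_arc_iff)
qed simp

section \<open>The parameters with \<open>q = - real l\<close>\<close>

lemma qnum_nonzero:
  assumes "2 \<le> \<bar>q\<bar>" "1 \<le> j" shows "qnum q j \<noteq> 0"
proof
  assume "qnum q j = 0"
  moreover have "(q - 1) * qnum q j = q ^ j - 1"
    unfolding qnum_def by (rule power_diff_1_eq[symmetric])
  ultimately have "q ^ j = 1" by simp
  then have "\<bar>q\<bar> ^ j = 1" by (simp flip: power_abs)
  moreover have "1 < \<bar>q\<bar> ^ j" using assms by (intro one_less_power) auto
  ultimately show False by simp
qed

theorem mainTheorem16:
  fixes d l :: nat
    and h :: "'k::{field,finite} ^ 'n::finite \<Rightarrow> 'k ^ 'n \<Rightarrow> 'k"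
    and \<alpha> \<beta> :: real
    and E :: "nat \<Rightarrow> ('k ^ 'n) set cmat"
  assumes "d \<ge> 3"
    and "primepow l"
    and "CARD('k) = l ^ 2"
    and "CARD('n) = 2 * d"
    and "hermitean_form l h"
    and "nondegenerate_form h"
    and "\<alpha> + 1 = (1 + real l ^ 2) / (1 - real l)"
    and "\<beta> + 1 = (1 - (- real l) ^ (d + 1)) / (1 - real l)"
    and "standard_ordering (dual_polar_graph d h) d (- real l) \<alpha> \<beta> E"
  shows "\<not> (\<exists>Y. nontrivial_descendent (dual_polar_graph d h) E Y)"
proof -
  have l: "2 \<le> l" using primepow_gt_Suc_0[OF assms(2)] by simp
  have qnum: "qnum (- real l) j \<noteq> 0" if "1 \<le> j" for j
    using that l by (intro qnum_nonzero) auto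
  \<comment> \<open>The index \<open>d - 1\<close> is positive, so the second summand is
    nonzero.\<close>
  have "qnum (- real l) d = 1 + - real l * qnum (- real l) (d - 1)"
    using qnum_add[of "- real l" 1 "d - 1"] assms(1) by (simp add: qnum_Suc)
  then have qnum_d: "qnum (- real l) d \<noteq> 1" using qnum[of "d - 1"] l assms(1) by simp
  \<comment> \<open>This makes \<open>\<alpha>\<close> less than -1.\<close>
  have "(1 + real l ^ 2) / (1 - real l) < 0"
    using l by (intro divide_pos_neg) (auto intro: add_pos_nonneg)
  then have \<alpha>: "\<alpha> \<noteq> 0" using assms(7) by linarith
  have "\<bar>(- real l) ^ (d + 1)\<bar> > 1"
    using l by (simp only: power_abs abs_minus_cancel abs_of_nat) (intro one_less_power, auto)
  then have "(- real l) ^ (d + 1) \<noteq> 1" by linarith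
  then have "(1 - (- real l) ^ (d + 1)) / (1 - real l) \<noteq> 0" using l by simp
  then have \<beta>: "\<beta> \<noteq> - 1" using assms(8) by linarith
  have "\<not> nontrivial_descendent (dual_polar_graph d h) E Y" for Y
  proof (rule no_nontrivial_descendent_if_local_graph_cliques[OF assms(9) _ _ qnum_d \<alpha> \<beta>])
    show "- real l \<noteq> 0" using l by simp
    show "qnum (- real l) j \<noteq> 0" if "1 \<le> j" "j \<le> d" for j using that(1) by (rule qnum)
  next
    fix x y z t
    assume arcs: "(x, y) \<in> parcs (dual_polar_graph d h)" "(x, z) \<in> parcs (dual_polar_graph d h)"
      "(x, t) \<in> parcs (dual_polar_graph d h)" "(y, z) \<in> parcs (dual_polar_graph d h)"
      "(z, t) \<in> parcs (dual_polar_graph d h)"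
    show "y = t \<or> (y, t) \<in> parcs (dual_polar_graph d h)"
      by (rule dual_polar_local_cliques[OF assms(5) _ _ arcs]) (use l assms(1) in simp_all)
  qed
  then show ?thesis by blast
qed

end
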